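(* Let $\mathbb{V}\in C^\infty(\mathcal{P}(I);\mathbb{R})$ and let $\beta>0$ be a scalar. Consider the Itô stochastic differential equation (gradient drift-diffusion process) on $\mathcal{P}(I)$ given, for $i\in I$, by $$dp_i(t)=\sum_{j\in N(i)}\sqrt{\omega_{ij}}\,\theta_{ij}(p(t))\Big(D_{ij}\Big[\mathbb{V}+\beta\log\frac{\Pi^{1/2}}{\theta_{ij}}\Big]\Big)(p(t))\,dt+\sqrt{\beta}\sum_{j\in N(i)}\sqrt{\omega_{ij}\theta_{ij}(p(t))}\,\big(dB_{ij}(t)-dB_{ji}(t)\big),$$ where $B_{ij}$, $1\le i,j\le n$, are independent standard Brownian motions. Then the Fokker–Planck equation of this SDE, for the probability density function $\mathbb{P}(t,p)$ of the process on $\mathcal{P}(I)$, is $$\frac{\partial}{\partial t}\mathbb{P}(t,p)=\nabla_p\cdot\big(\mathbb{P}(t,p)L(p)\nabla_p\mathbb{V}(p)\big)+\beta\,\mathsf{L}_W^*\mathbb{P}(t,p).$$ Assume that $Z:=\int_{\mathcal{P}(I)}e^{-\frac1\beta\mathbb{V}(p)}\Pi(p)^{-\frac12}\,dp<+\infty$. Then $$\mathbb{P}^*(p)=\frac1Z e^{-\frac1\beta\mathbb{V}(p)}\Pi(p)^{-\frac12}$$ is a stationary solution of this Fokker–Planck equation.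
   Context: **Graph.** $G=(I,E,\omega)$ is a finite connected undirected weighted graph without self-loops, $I=\{1,\dots,n\}$; $\omega=(\omega_{ij})\in\mathbb{R}^{n\times n}$ is symmetric with $\omega_{ij}=\omega_{ji}>0$ if $(i,j)\in E$ and $\omega_{ij}=0$ otherwise. $E$ consists of ordered pairs: each edge contributes both $(i,j)$ and $(j,i)$. $N(i)=\{j:(i,j)\in E\}$. Set $\pi_i=\frac{\sum_{j\in N(i)}\omega_{ij}}{\sum_{(k,l)\in E}\omega_{kl}}$. **Simplex.** $\mathcal{P}(I)=\{p\in\mathbb{R}^n:\sum_i p_i=1,\ p_i>0\}$, and $dp$ is the (Lebesgue) volume form on it. $\nabla_p$ and $\nabla_p\cdot$ are the gradient and divergence of $\mathbb{R}^n$. Functions on $\mathcal{P}(I)$ are differentiated after a smooth extension to a neighbourhood in $\mathbb{R}^n$; only the tangential derivatives $\frac{\partial}{\partial p_j}-\frac{\partial}{\partial p_i}$ enter. **Average function.** $\theta:[0,\infty)^2\to[0,\infty)$ satisfies $\theta(x,y)=\theta(y,x)$; $\theta(x,y)>0$ if $xy\ne0$; $\theta(x,y)=0$ if $xy=0$; and $\theta$ is $C^2$ on $(0,\infty)^2$. Write $\theta_{ij}(p)=\theta(p_i/\pi_i,p_j/\pi_j)$. **Weighted Laplacian matrix.** $L(p)\in\mathbb{R}^{n\times n}$ has entries $L(p)_{ij}=-\omega_{ij}\theta_{ij}(p)$ for $j\neq i$ and $L(p)_{ii}=\sum_{k\in N(i)}\omega_{ki}\theta_{ki}(p)$. For $p\in\mathcal{P}(I)$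 it is symmetric positive semidefinite with exactly one zero eigenvalue; $0<\lambda_1(p)\le\dots\le\lambda_{n-1}(p)$ are its positive eigenvalues, and $\Pi(p)=\prod_{i=1}^{n-1}\lambda_i(p)$. **Notation.** $D_{ij}F(p)=\sqrt{\omega_{ij}}\big(\frac{\partial}{\partial p_j}-\frac{\partial}{\partial p_i}\big)F(p)$; in $D_{ij}\log(\Pi^{1/2}/\theta_{ij})$ the indices $i,j$ are fixed (no summation). The operator $\mathsf{L}_W^*$ is $$\mathsf{L}_W^*\mathbb{P}(p)=\tfrac12\nabla_p\cdot\big(\mathbb{P}(p)L(p)\nabla_p\log\Pi(p)\big)+\nabla_p\cdot\big(L(p)\nabla_p\mathbb{P}(p)\big).$$ **Fokker–Planck equation.** For an Itô SDE with drift $b$ and covariation $d\langle p_i,p_j\rangle_t=c_{ij}(p_t)dt$, it is $\partial_t\mathbb{P}=\mathcal{A}^*\mathbb{P}$, where $\mathcal{A}^*$ is the formal adjoint with respect to $dp$ on $\mathcal{P}(I)$ of the generator $\mathcal{A}\Phi=b\cdot\nabla_p\Phi+\frac12\sum_{i,j}c_{ij}\frac{\partial^2\Phi}{\partial p_i\partial p_j}$; densities are with respect to $dp$. A stationary solution is a time-independent solution. *)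

theory Defs
  imports "HOL-Analysis.Analysis"
begin

text \<open>Differentiability of class \<open>C\<^sup>k\<close>; meant for open \<open>U\<close>.\<close>

primrec C_on :: "nat \<Rightarrow> ('a::euclidean_space \<Rightarrow> real) \<Rightarrow> 'a set \<Rightarrow> bool" where
  "C_on 0 f U \<longleftrightarrow> continuous_on U f"
| "C_on (Suc k) f U \<longleftrightarrow>
     f differentiable_on U \<and> (\<forall>b\<in>Basis. C_on k (\<lambda>x. frechet_derivative f (at x) b) U)"

definition pderiv_at :: "'n \<Rightarrow> (real^'n \<Rightarrow> real) \<Rightarrow> real^'n::finite \<Rightarrow> real" where
  "pderiv_at i F p = frechet_derivative F (at p) (axis i 1)"

definition grad :: "(real^'n \<Rightarrow> real) \<Rightarrow> real^'n::finite \<Rightarrow> real^'n" where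
  "grad F p = (\<chi> i. pderiv_at i F p)"

definition divergence :: "(real^'n \<Rightarrow> real^'n) \<Rightarrow> real^'n::finite \<Rightarrow> real" where
  "divergence X p = (\<Sum>i\<in>UNIV. pderiv_at i (\<lambda>q. X q $ i) p)"


definition simplex_interior :: "(real^'n::finite) set" where
  "simplex_interior = {p. (\<Sum>i\<in>UNIV. p $ i) = 1 \<and> (\<forall>i. 0 < p $ i)}"

text \<open>A function on the open simplex is represented by a function on \<open>\<real>\<^sup>n\<close> which is an extension
  of class \<open>C\<^sup>k\<close> on some open neighbourhood; its values outside that neighbourhood are irrelevant.\<close>

definition C_simplex :: "nat \<Rightarrow> (real^'n::finite \<Rightarrow> real) \<Rightarrow> bool" where
  "C_simplex k F \<longleftrightarrow> (\<exists>U. open U \<and> simplex_interior \<subseteq> U \<and> C_on k F U)"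

definition smooth_simplex :: "(real^'n::finite \<Rightarrow> real) \<Rightarrow> bool" where
  "smooth_simplex F \<longleftrightarrow> (\<exists>U. open U \<and> simplex_interior \<subseteq> U \<and> (\<forall>k. C_on k F U))"

text \<open>Euclidean \<open>(n-1)\<close>-dimensional volume on the hyperplane of vectors with coordinate sum \<open>1\<close>: the
  signed distance of \<open>x\<close> from it is \<open>((\<Sum>i. x\<^sub>i) - 1) / \<surd>n\<close>, so by Fubini the volume of a subset is the
  \<open>n\<close>-dimensional Lebesgue measure of the part of the slab of thickness \<open>1\<close> that projects
  orthogonally onto it.\<close>

definition hyperplane_volume :: "(real^'n::finite) measure" where
  "hyperplane_volume =
     distr (restrict_space lborel
              {x. ((\<Sum>i\<in>UNIV. x $ i) - 1) / sqrt (real CARD('n)) \<in> {0..1}})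
           borel
           (\<lambda>x. x - (\<chi> i. ((\<Sum>j\<in>UNIV. x $ j) - 1) / real CARD('n)))"

definition prob_density :: "(real^'n::finite \<Rightarrow> real) \<Rightarrow> bool" where
  "prob_density \<rho> \<longleftrightarrow>
     (\<forall>p\<in>simplex_interior. 0 \<le> \<rho> p) \<and>
     set_integrable hyperplane_volume simplex_interior \<rho> \<and>
     (LINT p:simplex_interior|hyperplane_volume. \<rho> p) = 1"


text \<open>An Ito equation \<open>dp = b(p) dt + \<sigma>(p) dB\<close> driven by independent standard Brownian motions
  \<open>(B\<^sub>m)\<close> is given by its drift \<open>b\<close> and its dispersion matrix \<open>\<sigma>\<close>; independence gives
  \<open>d\<langle>p\<^sub>i,p\<^sub>j\<rangle> = (\<sigma> \<sigma>\<^sup>T)\<^sub>i\<^sub>j dt\<close>.\<close>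

definition covariation :: "(real^'n \<Rightarrow> real^'m^'n) \<Rightarrow> real^'n::finite \<Rightarrow> real^'n^'n" where
  "covariation \<sigma> p = \<sigma> p ** transpose (\<sigma> p)"

definition generator ::
  "(real^'n \<Rightarrow> real^'n) \<Rightarrow> (real^'n \<Rightarrow> real^'n^'n) \<Rightarrow> (real^'n \<Rightarrow> real) \<Rightarrow> real^'n::finite \<Rightarrow> real" where
  "generator b c \<Phi> p =
     b p \<bullet> grad \<Phi> p +
     1/2 * (\<Sum>i\<in>UNIV. \<Sum>j\<in>UNIV. c p $ i $ j * pderiv_at i (pderiv_at j \<Phi>) p)"

text \<open>The generator is of second order, so the test functions are those of class \<open>C\<^sup>2\<close> with compact
  support in the open simplex (the extension off the simplex need not vanish).\<close>

definition test_function :: "(real^'n::finite \<Rightarrow> real) \<Rightarrow> bool" where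
  "test_function \<Phi> \<longleftrightarrow>
     C_simplex 2 \<Phi> \<and>
     (\<exists>K. compact K \<and> K \<subseteq> simplex_interior \<and> (\<forall>p\<in>simplex_interior - K. \<Phi> p = 0))"

text \<open>\<open>formal_adjoint A f g\<close> says \<open>A\<^sup>* f = g\<close> on the simplex; continuity of \<open>g\<close> makes \<open>g\<close>
  unique there.\<close>

definition formal_adjoint ::
  "((real^'n \<Rightarrow> real) \<Rightarrow> real^'n \<Rightarrow> real) \<Rightarrow> (real^'n \<Rightarrow> real) \<Rightarrow> (real^'n::finite \<Rightarrow> real) \<Rightarrow> bool" where
  "formal_adjoint A f g \<longleftrightarrow>
     continuous_on simplex_interior g \<and>
     (\<forall>\<Phi>. test_function \<Phi> \<longrightarrow>
        set_integrable hyperplane_volume simplex_interior (\<lambda>p. A \<Phi> p * f p) \<and>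
        set_integrable hyperplane_volume simplex_interior (\<lambda>p. \<Phi> p * g p) \<and>
        (LINT p:simplex_interior|hyperplane_volume. A \<Phi> p * f p) =
        (LINT p:simplex_interior|hyperplane_volume. \<Phi> p * g p))"

text \<open>The equation \<open>\<partial>\<^sub>t P = A\<^sup>* P\<close> on the simplex, at the time \<open>t\<close>.\<close>

definition fokker_planck_at ::
  "(real^'n \<Rightarrow> real^'n) \<Rightarrow> (real^'n \<Rightarrow> real^'m^'n) \<Rightarrow>
   (real \<Rightarrow> real^'n::finite \<Rightarrow> real) \<Rightarrow> real \<Rightarrow> bool" where
  "fokker_planck_at b \<sigma> P t \<longleftrightarrow>
     (\<exists>g. formal_adjoint (generator b (covariation \<sigma>)) (P t) g \<and>
          (\<forall>p\<in>simplex_interior. ((\<lambda>s. P s p) has_real_derivative g p) (at t)))"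

definition stationary_solution ::
  "(real^'n \<Rightarrow> real^'n) \<Rightarrow> (real^'n \<Rightarrow> real^'m^'n) \<Rightarrow> (real^'n::finite \<Rightarrow> real) \<Rightarrow> bool" where
  "stationary_solution b \<sigma> \<rho> \<longleftrightarrow>
     C_simplex 2 \<rho> \<and> (\<forall>t. fokker_planck_at b \<sigma> (\<lambda>_. \<rho>) t)"


definition weighted_graph :: "('n::finite \<times> 'n) set \<Rightarrow> real^'n^'n \<Rightarrow> bool" where
  "weighted_graph E \<omega> \<longleftrightarrow>
     sym E \<and> irrefl E \<and> (\<forall>i j. (i, j) \<in> E\<^sup>*) \<and>
     (\<forall>i j. \<omega> $ i $ j = \<omega> $ j $ i) \<and>
     (\<forall>i j. if (i, j) \<in> E then \<omega> $ i $ j > 0 else \<omega> $ i $ j = 0)"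

definition nbrs :: "('n::finite \<times> 'n) set \<Rightarrow> 'n \<Rightarrow> 'n set" where
  "nbrs E i = {j. (i, j) \<in> E}"

definition vertex_weight :: "('n::finite \<times> 'n) set \<Rightarrow> real^'n^'n \<Rightarrow> 'n \<Rightarrow> real" where
  "vertex_weight E \<omega> i = (\<Sum>j\<in>nbrs E i. \<omega> $ i $ j) / (\<Sum>(k, l)\<in>E. \<omega> $ k $ l)"

definition average_function :: "(real \<Rightarrow> real \<Rightarrow> real) \<Rightarrow> bool" where
  "average_function \<theta> \<longleftrightarrow>
     (\<forall>x\<ge>0. \<forall>y\<ge>0. 0 \<le> \<theta> x y \<and> \<theta> x y = \<theta> y x \<and>
        (x * y \<noteq> 0 \<longrightarrow> 0 < \<theta> x y) \<and> (x * y = 0 \<longrightarrow> \<theta> x y = 0)) \<and>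
     C_on 2 (\<lambda>(x, y). \<theta> x y) ({0<..} \<times> {0<..})"

definition edge_theta ::
  "('n::finite \<times> 'n) set \<Rightarrow> real^'n^'n \<Rightarrow> (real \<Rightarrow> real \<Rightarrow> real) \<Rightarrow> 'n \<Rightarrow> 'n \<Rightarrow> real^'n \<Rightarrow> real" where
  "edge_theta E \<omega> \<theta> i j p = \<theta> (p $ i / vertex_weight E \<omega> i) (p $ j / vertex_weight E \<omega> j)"

definition laplacian ::
  "('n::finite \<times> 'n) set \<Rightarrow> real^'n^'n \<Rightarrow> (real \<Rightarrow> real \<Rightarrow> real) \<Rightarrow> real^'n \<Rightarrow> real^'n^'n" where
  "laplacian E \<omega> \<theta> p =
     (\<chi> i j. if j = i then \<Sum>k\<in>nbrs E i. \<omega> $ k $ i * edge_theta E \<omega> \<theta> k i p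
             else - \<omega> $ i $ j * edge_theta E \<omega> \<theta> i j p)"

text \<open>Eigenvalues are counted with the dimension of the eigenspace, which for the symmetric
  matrices considered here is the same as the algebraic multiplicity.\<close>

definition eigenspace :: "real^'n^'n \<Rightarrow> real \<Rightarrow> (real^'n::finite) set" where
  "eigenspace A l = {v. A *v v = l *\<^sub>R v}"

definition pos_eigenvalues :: "real^'n^'n::finite \<Rightarrow> real set" where
  "pos_eigenvalues A = {l. 0 < l \<and> (\<exists>v. v \<noteq> 0 \<and> A *v v = l *\<^sub>R v)}"

definition eig_prod ::
  "('n::finite \<times> 'n) set \<Rightarrow> real^'n^'n \<Rightarrow> (real \<Rightarrow> real \<Rightarrow> real) \<Rightarrow> real^'n \<Rightarrow> real" where
  "eig_prod E \<omega> \<theta> p =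
     (\<Prod>l\<in>pos_eigenvalues (laplacian E \<omega> \<theta> p). l ^ dim (eigenspace (laplacian E \<omega> \<theta> p) l))"

definition edge_deriv :: "real^'n^'n \<Rightarrow> 'n \<Rightarrow> 'n \<Rightarrow> (real^'n \<Rightarrow> real) \<Rightarrow> real^'n::finite \<Rightarrow> real" where
  "edge_deriv \<omega> i j F p = sqrt (\<omega> $ i $ j) * (pderiv_at j F p - pderiv_at i F p)"

definition LW_adj ::
  "('n::finite \<times> 'n) set \<Rightarrow> real^'n^'n \<Rightarrow> (real \<Rightarrow> real \<Rightarrow> real) \<Rightarrow>
   (real^'n \<Rightarrow> real) \<Rightarrow> real^'n \<Rightarrow> real" where
  "LW_adj E \<omega> \<theta> P p =
     1/2 * divergence (\<lambda>q. P q *\<^sub>R (laplacian E \<omega> \<theta> q *v grad (\<lambda>r. ln (eig_prod E \<omega> \<theta> r)) q)) p +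
     divergence (\<lambda>q. laplacian E \<omega> \<theta> q *v grad P q) p"

definition sde_drift ::
  "('n::finite \<times> 'n) set \<Rightarrow> real^'n^'n \<Rightarrow> (real \<Rightarrow> real \<Rightarrow> real) \<Rightarrow> (real^'n \<Rightarrow> real) \<Rightarrow> real \<Rightarrow>
   real^'n \<Rightarrow> real^'n" where
  "sde_drift E \<omega> \<theta> V \<beta> p =
     (\<chi> i. \<Sum>j\<in>nbrs E i. sqrt (\<omega> $ i $ j) * edge_theta E \<omega> \<theta> i j p *
        edge_deriv \<omega> i j
          (\<lambda>q. V q + \<beta> * ln (eig_prod E \<omega> \<theta> q powr (1/2) / edge_theta E \<omega> \<theta> i j q)) p)"

text \<open>The Brownian motions are indexed by ordered pairs \<open>m\<close>; entry \<open>(i, m)\<close> is the coefficient of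
  \<open>dB\<^sub>m\<close> in \<open>\<surd>\<beta> \<Sum>j\<in>N(i). \<surd>(\<omega>\<^sub>i\<^sub>j \<theta>\<^sub>i\<^sub>j) (dB\<^sub>i\<^sub>j - dB\<^sub>j\<^sub>i)\<close>.\<close>

definition sde_dispersion ::
  "('n::finite \<times> 'n) set \<Rightarrow> real^'n^'n \<Rightarrow> (real \<Rightarrow> real \<Rightarrow> real) \<Rightarrow> real \<Rightarrow>
   real^'n \<Rightarrow> real^('n \<times> 'n)^'n" where
  "sde_dispersion E \<omega> \<theta> \<beta> p =
     (\<chi> i m. sqrt \<beta> * (\<Sum>j\<in>nbrs E i. sqrt (\<omega> $ i $ j * edge_theta E \<omega> \<theta> i j p) *
        (of_bool (m = (i, j)) - of_bool (m = (j, i)))))"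

definition gibbs_weight ::
  "('n::finite \<times> 'n) set \<Rightarrow> real^'n^'n \<Rightarrow> (real \<Rightarrow> real \<Rightarrow> real) \<Rightarrow> (real^'n \<Rightarrow> real) \<Rightarrow> real \<Rightarrow>
   real^'n \<Rightarrow> real" where
  "gibbs_weight E \<omega> \<theta> V \<beta> p = exp (- (1 / \<beta>) * V p) * eig_prod E \<omega> \<theta> p powr (- (1/2))"

end

theory Submission
  imports Defs
begin

text \<open>Put \<open>S = V + \<beta>/2 \<cdot> log \<Pi>\<close>. The drift looks as if it mixed \<open>V\<close>, \<open>\<Pi>\<close> and the averages \<open>\<theta>\<^sub>i\<^sub>j\<close>, but
\<open>\<theta>\<^sub>i\<^sub>j \<partial> log \<theta>\<^sub>i\<^sub>j = \<partial>\<theta>\<^sub>i\<^sub>j\<close> turns the last contribution into the divergence of the rows of the Laplacian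
matrix \<open>L\<close>. Hence the drift is \<open>\<beta> div L - L \<nabla>S\<close> (\<open>drift_eq\<close>), the covariation is \<open>2 \<beta> L\<close>
(\<open>covariation_eq\<close>), and the generator has the divergence form
\<open>A \<Phi> = \<beta> div (L \<nabla>\<Phi>) - \<nabla>\<Phi> \<bullet> L \<nabla>S\<close>.

For the flux \<open>J f = f L \<nabla>S + \<beta> L \<nabla>f\<close>, the product rule and the symmetry of \<open>L\<close> give
\<open>(A \<Phi>) f - \<Phi> div (J f) = div Y\<close> with \<open>Y = \<beta> f L \<nabla>\<Phi> - \<Phi> J f\<close>. The rows and columns of \<open>L\<close> sum to
zero. Therefore \<open>Y\<close> is parallel to the hyperplane that carries the simplex, and \<open>L \<nabla>\<Phi>\<close> involves only
tangential derivatives of \<open>\<Phi>\<close>, so that \<open>Y\<close> vanishes on the simplex off the support of \<open>\<Phi>\<close>. The integral of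
\<open>div Y\<close> is zero, because the volume of the hyperplane is invariant under its translations
(\<open>integral_divergence_tangential\<close>). This proves \<open>A\<^sup>* f = div (J f)\<close> (\<open>formal_adjoint_generator\<close>), and
expanding \<open>S\<close> gives the operator of the theorem. Bump functions show that no other continuous
function represents \<open>A\<^sup>* f\<close> (\<open>formal_adjoint_unique\<close>), so the two forms of the Fokker-Planck
equation are equivalent.

The Gibbs weight is \<open>exp (- S / \<beta>)\<close>, whose flux \<open>J\<close> vanishes identically; it is therefore stationary.

All this needs \<open>\<Pi>\<close> to be of class \<open>C\<^sup>2\<close>, which is not visible in its definition through eigenvalues
and dimensions of eigenspaces. The spectral theorem identifies it with the determinant of \<open>L\<close> plus
the constant matrix with entries \<open>1/n\<close> (\<open>eigenvalue_product_eq_det\<close>): that matrix moves the eigenvalue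
\<open>0\<close> to \<open>1\<close> and leaves the other eigenvalues alone.\<close>

section \<open>Calculus of functions of class \<open>C\<^sup>k\<close>\<close>

lemma C_on_SucD:
  assumes "open U" "C_on (Suc k) f U" "x \<in> U"
  shows "(f has_derivative frechet_derivative f (at x)) (at x)"
  using assms by (auto simp: differentiable_on_eq_differentiable_at frechet_derivative_works[symmetric])

lemma C_on_cong:
  assumes U: "open U" and "C_on k f U" "\<And>x. x \<in> U \<Longrightarrow> f x = g x"
  shows "C_on k g U"
  using assms(2,3)
proof (induction k arbitrary: f g)
  case 0
  then show ?case by (auto cong: continuous_on_cong)
next
  case (Suc k)
  have D: "(g has_derivative frechet_derivative f (at x)) (at x)" if x: "x \<in> U" for x
    using C_on_SucD[OF U Suc.prems(1) x] Suc.prems(2)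
    by (rule has_derivative_transform_within_open[OF _ U x])
  have eq: "frechet_derivative f (at x) = frechet_derivative g (at x)" if "x \<in> U" for x
    using frechet_derivative_at[OF D[OF that]] .
  from D have "g differentiable_on U"
    by (auto simp: differentiable_on_def differentiable_def intro: has_derivative_at_withinI)
  moreover have "C_on k (\<lambda>x. frechet_derivative g (at x) b) U" if "b \<in> Basis" for b
    by (rule Suc.IH[of "\<lambda>x. frechet_derivative f (at x) b"]) (use Suc.prems(1) that eq in auto)
  ultimately show ?case by simp
qed

lemma C_on_SucI:
  assumes "open U" "\<And>x. x \<in> U \<Longrightarrow> (f has_derivative f' x) (at x)"
    and "\<And>b. b \<in> Basis \<Longrightarrow> C_on k (\<lambda>x. f' x b) U"
  shows "C_on (Suc k) f U"
proof -
  have "frechet_derivative f (at x) = f' x" if "x \<in> U" for x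
    using frechet_derivative_at[OF assms(2)[OF that]] by simp
  then have "C_on k (\<lambda>x. frechet_derivative f (at x) b) U" if "b \<in> Basis" for b
    using C_on_cong[OF assms(1) assms(3)[OF that]] by simp
  moreover have "f differentiable_on U"
    using assms(2) by (auto simp: differentiable_on_def differentiable_def intro: has_derivative_at_withinI)
  ultimately show ?thesis by simp
qed

lemma C_on_subset:
  assumes "open U" "open V" "V \<subseteq> U" "C_on k f U"
  shows "C_on k f V"
  using assms(4)
proof (induction k arbitrary: f)
  case 0
  then show ?case using assms(3) continuous_on_subset by auto
next
  case (Suc k)
  then show ?case using assms(3) differentiable_on_subset by auto
qed

lemma C_on_continuous_on:
  assumes "C_on k f U" shows "continuous_on U f"
  using assms by (cases k) (auto intro: differentiable_imp_continuous_on)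

lemma C_on_Suc_le:
  assumes "C_on (Suc k) f U" shows "C_on k f U"
  using assms
  by (induction k arbitrary: f) (auto intro: differentiable_imp_continuous_on)

lemma C_on_const: "open U \<Longrightarrow> C_on k (\<lambda>x. c) U"
  by (induction k arbitrary: c) (auto intro!: C_on_SucI[where f' = "\<lambda>_ _. 0"] simp del: C_on.simps(2))

lemma C_on_bounded_linear:
  assumes "open U" "bounded_linear f" shows "C_on k f U"
proof (cases k)
  case 0
  then show ?thesis using assms by (simp add: linear_continuous_on)
next
  case (Suc l)
  show ?thesis unfolding Suc
    using assms by (intro C_on_SucI[where f' = "\<lambda>_. f"] C_on_const bounded_linear_imp_has_derivative)
qed

lemma C_on_nth: "open U \<Longrightarrow> C_on k (\<lambda>x::real^'n. x $ i) U"
  by (intro C_on_bounded_linear bounded_linear_vec_nth)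

lemma C_on_add:
  assumes "open U" "C_on k f U" "C_on k g U"
  shows "C_on k (\<lambda>x. f x + g x) U"
  using assms(2,3)
proof (induction k arbitrary: f g)
  case 0
  then show ?case by (auto intro: continuous_on_add)
next
  case (Suc k)
  show ?case
  proof (rule C_on_SucI[OF assms(1)])
    fix x assume x: "x \<in> U"
    show "((\<lambda>x. f x + g x) has_derivative
        (\<lambda>h. frechet_derivative f (at x) h + frechet_derivative g (at x) h)) (at x)"
      using Suc.prems[THEN C_on_SucD[OF assms(1) _ x]] by (rule has_derivative_add)
  qed (use Suc in auto)
qed

lemma C_on_mult:
  assumes "open U" "C_on k f U" "C_on k g U"
  shows "C_on k (\<lambda>x. f x * g x) U"
  using assms(2,3)
proof (induction k arbitrary: f g)
  case 0
  then show ?case by (auto intro: continuous_on_mult)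
next
  case (Suc k)
  show ?case
  proof (rule C_on_SucI[OF assms(1)])
    fix x assume x: "x \<in> U"
    show "((\<lambda>x. f x * g x) has_derivative
        (\<lambda>h. f x * frechet_derivative g (at x) h + frechet_derivative f (at x) h * g x)) (at x)"
      using Suc.prems[THEN C_on_SucD[OF assms(1) _ x]] by (rule has_derivative_mult)
  next
    fix b :: 'a assume "b \<in> Basis"
    then show "C_on k (\<lambda>x. f x * frechet_derivative g (at x) b + frechet_derivative f (at x) b * g x) U"
      using Suc.prems Suc.prems[THEN C_on_Suc_le] by (intro C_on_add[OF assms(1)] Suc.IH) auto
  qed
qed

lemma C_on_sum:
  assumes "open U" "\<And>i. i \<in> I \<Longrightarrow> C_on k (f i) U"
  shows "C_on k (\<lambda>x. \<Sum>i\<in>I. f i x) U"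
  using assms(2)
  by (induction I rule: infinite_finite_induct) (auto intro: C_on_const C_on_add assms(1))

lemma C_on_prod:
  assumes "open U" "\<And>i. i \<in> I \<Longrightarrow> C_on k (f i) U"
  shows "C_on k (\<lambda>x. \<Prod>i\<in>I. f i x) U"
  using assms(2)
  by (induction I rule: infinite_finite_induct) (auto intro: C_on_const C_on_mult assms(1))

lemma C_on_cmult: "open U \<Longrightarrow> C_on k f U \<Longrightarrow> C_on k (\<lambda>x. c * f x) U"
  by (intro C_on_mult C_on_const)

lemma C_on_minus: "open U \<Longrightarrow> C_on k f U \<Longrightarrow> C_on k (\<lambda>x. - f x) U"
  using C_on_cmult[of U k f "-1"] by simp

lemma C_on_diff: "open U \<Longrightarrow> C_on k f U \<Longrightarrow> C_on k g U \<Longrightarrow> C_on k (\<lambda>x. f x - g x) U"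
  using C_on_add[of U k f "\<lambda>x. - g x"] C_on_minus[of U k g] by simp

text \<open>The chain rule expresses the partial derivatives of \<open>F \<circ> g\<close> as sums of products of functions of one
class lower, so induction on \<open>k\<close> applies. It covers both the scalar functions applied to \<open>\<Pi>\<close> and the
average function, which is applied to two coordinates at once.\<close>

lemma C_on_compose:
  fixes F :: "'b::euclidean_space \<Rightarrow> real" and g :: "'a::euclidean_space \<Rightarrow> 'b"
  assumes U: "open U" and T: "open T" and "C_on k F T" and gT: "\<And>x. x \<in> U \<Longrightarrow> g x \<in> T"
    and "\<And>b. b \<in> Basis \<Longrightarrow> C_on k (\<lambda>x. g x \<bullet> b) U"
  shows "C_on k (\<lambda>x. F (g x)) U"
  using assms(3,5)
proof (induction k arbitrary: F)
  case 0
  then have "continuous_on U g"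
    by (subst continuous_on_componentwise) auto
  then show ?case
    using 0 gT continuous_on_compose2[of T F U g] by auto
next
  case (Suc k)
  define D where "D x h = (\<Sum>b\<in>Basis. frechet_derivative (\<lambda>x. g x \<bullet> b) (at x) h *\<^sub>R b)" for x h
  have D: "(g has_derivative D x) (at x)" if "x \<in> U" for x
    by (subst has_derivative_componentwise_within)
       (auto simp: D_def inner_sum_left_Basis intro: C_on_SucD[OF U Suc.prems(2) that])
  show ?case
  proof (rule C_on_SucI[OF U])
    fix x assume x: "x \<in> U"
    have F: "(F has_derivative frechet_derivative F (at (g x))) (at (g x))"
      using C_on_SucD[OF T Suc.prems(1) gT[OF x]] .
    have "((\<lambda>x. F (g x)) has_derivative (\<lambda>h. frechet_derivative F (at (g x)) (D x h))) (at x)"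
      using diff_chain_at[OF D[OF x] F] by (simp add: o_def)
    also have "(\<lambda>h. frechet_derivative F (at (g x)) (D x h)) =
      (\<lambda>h. \<Sum>b\<in>Basis. frechet_derivative (\<lambda>x. g x \<bullet> b) (at x) h * frechet_derivative F (at (g x)) b)"
      using has_derivative_linear[OF F] by (auto simp: D_def linear_sum linear_cmul)
    finally show "((\<lambda>x. F (g x)) has_derivative \<dots>) (at x)" .
  next
    fix c :: 'a assume c: "c \<in> Basis"
    have "C_on k (\<lambda>x. frechet_derivative F (at (g x)) b) U" if "b \<in> Basis" for b
    proof (rule Suc.IH[of "\<lambda>y. frechet_derivative F (at y) b"])
      show "C_on k (\<lambda>x. g x \<bullet> b) U" if "b \<in> Basis" for b
        using Suc.prems(2)[OF that] by (rule C_on_Suc_le)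
    qed (use Suc.prems(1) that in auto)
    then show "C_on k (\<lambda>x. \<Sum>b\<in>Basis. frechet_derivative (\<lambda>x. g x \<bullet> b) (at x) c *
        frechet_derivative F (at (g x)) b) U"
      using Suc.prems(2) c by (intro C_on_sum C_on_mult U) auto
  qed
qed

lemma C_on_compose_real:
  fixes F :: "real \<Rightarrow> real"
  assumes "open U" "open T" "C_on k F T" "\<And>x. x \<in> U \<Longrightarrow> g x \<in> T" "C_on k g U"
  shows "C_on k (\<lambda>x. F (g x)) U"
  by (rule C_on_compose[OF assms(1-4)]) (use assms(5) in auto)

lemma C_on_Suc_real:
  assumes "open T" "\<And>x. x \<in> T \<Longrightarrow> (f has_real_derivative f' x) (at x)" "C_on k f' T"
  shows "C_on (Suc k) f T"
  using assms(1,3)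
  by (intro C_on_SucI[where f' = "\<lambda>x h. f' x * h"])
     (auto simp: has_field_derivative_def[symmetric] assms(2))

lemma C_on_exp: "C_on k exp (UNIV :: real set)"
proof (induction k)
  case (Suc k)
  then show ?case by (intro C_on_Suc_real[where f' = exp] DERIV_exp) auto
qed (simp add: continuous_on_exp)

lemma C_on_inverse: "C_on k inverse {0::real<..}"
proof (induction k)
  case (Suc k)
  show ?case
    by (rule C_on_Suc_real[where f' = "\<lambda>x. - (inverse x * inverse x)"])
       (auto intro!: C_on_minus C_on_mult Suc DERIV_inverse' derivative_eq_intros simp: power2_eq_square)
qed (auto intro!: continuous_on_inverse continuous_on_id)

lemma C_on_ln: "C_on k ln {0::real<..}"
proof (cases k)
  case (Suc l)
  have "C_on (Suc l) ln {0::real<..}"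
    by (rule C_on_Suc_real[where f' = inverse]) (auto intro!: C_on_inverse DERIV_ln)
  then show ?thesis using Suc by simp
qed (auto intro!: continuous_on_ln continuous_on_id)


lemma pderiv_at_eqI: "(F has_derivative F') (at p) \<Longrightarrow> pderiv_at i F p = F' (axis i 1)"
  using frechet_derivative_at[of F F' p] by (simp add: pderiv_at_def)

text \<open>Partial derivatives are local; this is how identities that hold only near the simplex, or
only on the orthant, are differentiated.\<close>

lemma pderiv_at_transform:
  assumes "open U" "p \<in> U" "\<And>q. q \<in> U \<Longrightarrow> F q = G q"
  shows "pderiv_at i F p = pderiv_at i G p"
proof -
  have "(F has_derivative D) (at p) \<longleftrightarrow> (G has_derivative D) (at p)" for D
    using assms has_derivative_transform_within_open[of _ D p UNIV U] by metis
  then show ?thesis unfolding pderiv_at_def frechet_derivative_def by simp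
qed

lemma C_on_pderiv: "C_on (Suc k) F U \<Longrightarrow> C_on k (pderiv_at i F) (U :: (real^'n) set)"
  by (auto simp: pderiv_at_def[abs_def] Basis_vec_def)

lemma pderiv_at_const [simp]: "pderiv_at i (\<lambda>_. c) p = 0"
  by (subst pderiv_at_eqI[OF has_derivative_const]) simp

lemma pderiv_at_add:
  assumes "f differentiable (at p)" "g differentiable (at p)"
  shows "pderiv_at i (\<lambda>q. f q + g q) p = pderiv_at i f p + pderiv_at i g p"
  using assms unfolding frechet_derivative_works
  by (subst pderiv_at_eqI[OF has_derivative_add]) (auto simp: pderiv_at_def)

lemma pderiv_at_mult:
  assumes "f differentiable (at p)" "g differentiable (at p)"
  shows "pderiv_at i (\<lambda>q. f q * g q) p = f p * pderiv_at i g p + pderiv_at i f p * g p"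
  using assms unfolding frechet_derivative_works
  by (subst pderiv_at_eqI[OF has_derivative_mult]) (auto simp: pderiv_at_def)

lemma pderiv_at_cmult:
  assumes "f differentiable (at p)"
  shows "pderiv_at i (\<lambda>q. c * f q) p = c * pderiv_at i f p"
  using pderiv_at_mult[of "\<lambda>_. c" p f i] assms by simp

lemma pderiv_at_minus:
  assumes "f differentiable (at p)"
  shows "pderiv_at i (\<lambda>q. - f q) p = - pderiv_at i f p"
  using pderiv_at_cmult[OF assms, of i "-1"] by simp

lemma pderiv_at_diff:
  assumes "f differentiable (at p)" "g differentiable (at p)"
  shows "pderiv_at i (\<lambda>q. f q - g q) p = pderiv_at i f p - pderiv_at i g p"
  using assms unfolding frechet_derivative_works
  by (subst pderiv_at_eqI[OF has_derivative_diff]) (auto simp: pderiv_at_def)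

lemma pderiv_at_sum:
  assumes "\<And>j. j \<in> J \<Longrightarrow> f j differentiable (at p)"
  shows "pderiv_at i (\<lambda>q. \<Sum>j\<in>J. f j q) p = (\<Sum>j\<in>J. pderiv_at i (f j) p)"
  using assms
  by (induction J rule: infinite_finite_induct) (auto simp: pderiv_at_add)

lemma pderiv_at_compose_real:
  assumes "f differentiable (at p)" "(\<phi> has_real_derivative d) (at (f p))"
  shows "pderiv_at i (\<lambda>q. \<phi> (f q)) p = d * pderiv_at i f p"
proof -
  have "((\<lambda>q. \<phi> (f q)) has_derivative (\<lambda>h. d * frechet_derivative f (at p) h)) (at p)"
    using diff_chain_at[OF assms(1)[unfolded frechet_derivative_works]] assms(2)
    by (auto simp: o_def has_field_derivative_def)
  from pderiv_at_eqI[OF this] show ?thesis by (simp add: pderiv_at_def)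
qed

lemma C_on_differentiable:
  assumes "open U" "C_on k f U" "0 < k" "p \<in> U"
  shows "f differentiable (at p)"
  using assms by (cases k) (auto simp: differentiable_on_eq_differentiable_at)

section \<open>The volume of the hyperplane\<close>

text \<open>The hyperplane volume is the image of Lebesgue measure on this slab under orthogonal projection.\<close>

definition slab :: "(real^'n::finite) set" where
  "slab = {x. ((\<Sum>i\<in>UNIV. x $ i) - 1) / sqrt (real CARD('n)) \<in> {0..1}}"

definition hyperplane_proj :: "real^'n \<Rightarrow> real^'n::finite" where
  "hyperplane_proj x = x - (\<chi> i. ((\<Sum>j\<in>UNIV. x $ j) - 1) / real CARD('n))"

lemma hyperplane_volume_eq:
  "hyperplane_volume = distr (restrict_space lborel slab) borel hyperplane_proj"
  unfolding hyperplane_volume_def slab_def hyperplane_proj_def ..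

lemma sets_hyperplane_volume [simp, measurable_cong]: "sets hyperplane_volume = sets borel"
  and space_hyperplane_volume [simp]: "space hyperplane_volume = UNIV"
  by (simp_all add: hyperplane_volume_def)

lemma slab_borel [measurable]: "slab \<in> sets borel"
proof -
  have "closed ((\<lambda>x::real^'n. ((\<Sum>i\<in>UNIV. x $ i) - 1) / sqrt (real CARD('n))) -` {0..1})"
    by (intro closed_vimage continuous_intros) auto
  moreover have "\<dots> = (slab :: (real^'n) set)"
    by (auto simp: slab_def)
  ultimately show ?thesis by (metis borel_closed)
qed

lemma continuous_on_hyperplane_proj: "continuous_on UNIV hyperplane_proj"
  unfolding hyperplane_proj_def by (intro continuous_intros) auto

lemma hyperplane_proj_measurable [measurable]: "hyperplane_proj \<in> borel_measurable borel"
  by (intro borel_measurable_continuous_onI continuous_on_hyperplane_proj)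

lemma sum_hyperplane_proj: "(\<Sum>i\<in>UNIV. hyperplane_proj x $ i) = 1"
  by (simp add: hyperplane_proj_def sum_subtractf)

lemma emeasure_hyperplane_volume:
  assumes [measurable]: "A \<in> sets borel"
  shows "emeasure hyperplane_volume A = emeasure lborel (hyperplane_proj -` A \<inter> slab)"
proof -
  have m: "hyperplane_proj \<in> restrict_space lborel slab \<rightarrow>\<^sub>M borel"
    by (intro measurable_restrict_space1) simp
  show ?thesis
    unfolding hyperplane_volume_eq
    by (subst emeasure_distr[OF m]) (auto simp: emeasure_restrict_space space_restrict_space Int_commute)
qed

lemma emeasure_hyperplane_volume_bounded:
  fixes A :: "(real^'n::finite) set"
  assumes [measurable]: "A \<in> sets borel" and "bounded A"
  shows "emeasure hyperplane_volume A < \<infinity>"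
proof -
  obtain R where R: "\<And>x. x \<in> A \<Longrightarrow> norm x \<le> R"
    using \<open>bounded A\<close> by (auto simp: bounded_iff)
  have "norm x \<le> R + real CARD('n)" if "hyperplane_proj x \<in> A" "x \<in> slab" for x :: "real^'n"
  proof -
    define c where "c = ((\<Sum>j\<in>UNIV. x $ j) - 1) / real CARD('n)"
    define r where "r = ((\<Sum>j\<in>UNIV. x $ j) - 1) / sqrt (real CARD('n))"
    have "0 \<le> r" "r \<le> 1" using that(2) by (auto simp: slab_def r_def)
    moreover have "c = r / sqrt (real CARD('n))"
      by (simp add: c_def r_def)
    moreover have "r / sqrt (real CARD('n)) \<le> r / 1"
      using \<open>0 \<le> r\<close> by (intro divide_left_mono) (simp_all add: Suc_leI)
    moreover have "0 \<le> r / sqrt (real CARD('n))"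
      using \<open>0 \<le> r\<close> by simp
    ultimately have "\<bar>c\<bar> \<le> 1" by linarith
    have "norm (\<chi> i::'n. c) \<le> (\<Sum>i\<in>(UNIV::'n set). \<bar>c\<bar>)"
      using norm_le_l1_cart[of "\<chi> i::'n. c"] by simp
    also have "\<dots> \<le> (\<Sum>i\<in>(UNIV::'n set). 1)"
      using \<open>\<bar>c\<bar> \<le> 1\<close> by (intro sum_mono)
    finally have "norm (\<chi> i::'n. c) \<le> real CARD('n)" by simp
    moreover have "x = hyperplane_proj x + (\<chi> i. c)"
      by (simp add: hyperplane_proj_def c_def)
    ultimately show ?thesis
      using R[OF that(1)] norm_triangle_ineq[of "hyperplane_proj x" "\<chi> i. c"] by simp
  qed
  then have "bounded (hyperplane_proj -` A \<inter> slab)"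
    by (auto simp: bounded_iff)
  then show ?thesis
    by (auto simp: emeasure_hyperplane_volume dest!: emeasure_bounded_finite)
qed

text \<open>A vector with coordinate sum zero is parallel to the hyperplane: translation by it preserves the
slab and commutes with the projection, so the invariance is that of Lebesgue measure.\<close>

lemma hyperplane_volume_translation:
  assumes "(\<Sum>i\<in>UNIV. v $ i) = 0"
  shows "distr hyperplane_volume borel (\<lambda>x. x + v) = hyperplane_volume"
proof (rule measure_eqI)
  fix A assume "A \<in> sets (distr hyperplane_volume borel (\<lambda>x. x + v))"
  then have [measurable]: "A \<in> sets borel" by simp
  have [measurable]: "(\<lambda>x. x + v) -` A \<in> sets borel"
    using measurable_sets[of "\<lambda>x. x + v" borel borel A] by simp
  let ?S = "hyperplane_proj -` A \<inter> slab"
  have S: "?S \<in> sets borel"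
    using measurable_sets[OF hyperplane_proj_measurable \<open>A \<in> sets borel\<close>] slab_borel by auto
  have *: "((\<lambda>x. v + x) -` ?S) = (hyperplane_proj -` ((\<lambda>x. x + v) -` A) \<inter> slab)"
    using assms by (auto simp: hyperplane_proj_def slab_def sum.distrib algebra_simps)
  have "emeasure (distr hyperplane_volume borel (\<lambda>x. x + v)) A =
      emeasure lborel (hyperplane_proj -` ((\<lambda>x. x + v) -` A) \<inter> slab)"
    by (simp add: emeasure_distr emeasure_hyperplane_volume)
  also have "\<dots> = emeasure (distr lborel borel ((+) v)) ?S"
    using S by (simp only: emeasure_distr[OF _ S[folded sets_lborel]] *[symmetric]) (simp add: emeasure_distr)
  also have "\<dots> = emeasure hyperplane_volume A"
    by (simp add: lborel_distr_plus emeasure_hyperplane_volume)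
  finally show "emeasure (distr hyperplane_volume borel (\<lambda>x. x + v)) A = emeasure hyperplane_volume A" .
qed simp

lemma integral_hyperplane_volume_translate:
  assumes "(\<Sum>i\<in>UNIV. v $ i) = 0" and [measurable]: "f \<in> borel_measurable borel"
  shows "(LINT x|hyperplane_volume. f (x + v)) = (LINT x|hyperplane_volume. (f x :: real))"
  using integral_distr[of "\<lambda>x. x + v" hyperplane_volume borel f]
  by (simp add: hyperplane_volume_translation[OF assms(1)])

lemma integrable_hyperplane_volume_translate:
  assumes "(\<Sum>i\<in>UNIV. v $ i) = 0" and "integrable hyperplane_volume f"
  shows "integrable hyperplane_volume (\<lambda>x. f (x + v) :: real)"
proof -
  have "f \<in> borel_measurable borel"
    using borel_measurable_integrable[OF assms(2)] by simp
  then show ?thesis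
    using integrable_distr_eq[of "\<lambda>x. x + v" hyperplane_volume borel f] assms(2)
    by (simp add: hyperplane_volume_translation[OF assms(1)])
qed

text \<open>An open neighbourhood of the open simplex on which the averages \<open>\<theta>\<^sub>i\<^sub>j\<close> of adjacent vertices are positive and
of class \<open>C\<^sup>2\<close>, so that \<open>L\<close> is still the Laplacian matrix of a connected graph.\<close>

definition orthant :: "(real^'n::finite) set" where
  "orthant = {p. \<forall>i. 0 < p $ i}"

lemma open_orthant: "open orthant"
proof -
  have "open (\<Inter>i. {p :: real^'n. 0 < p $ i})"
    by (intro open_INT ballI open_Collect_less continuous_intros) auto
  also have "(\<Inter>i. {p :: real^'n. 0 < p $ i}) = orthant" by (auto simp: orthant_def)
  finally show ?thesis .
qed

lemma simplex_interior_eq: "simplex_interior = orthant \<inter> {p. (\<Sum>i\<in>UNIV. p $ i) = 1}"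
  by (auto simp: simplex_interior_def orthant_def)

lemma simplex_subset_orthant: "simplex_interior \<subseteq> orthant"
  by (auto simp: simplex_interior_eq)

lemma simplex_borel [measurable]: "simplex_interior \<in> sets borel"
  unfolding simplex_interior_eq
  by (intro sets.Int borel_open[OF open_orthant] borel_closed closed_Collect_eq continuous_intros)

text \<open>Every point \<open>p\<close> of the simplex is the projection of interior points of the slab (those above \<open>p\<close>,
for instance at half the thickness), so the preimage of a neighbourhood of \<open>p\<close> contains a nonempty
open set.\<close>

lemma emeasure_hyperplane_volume_pos:
  assumes W: "open W" and p: "p \<in> W \<inter> simplex_interior"
  shows "0 < emeasure hyperplane_volume (W \<inter> simplex_interior :: (real^'n::finite) set)"
proof -
  let ?h = "\<lambda>x::real^'n. ((\<Sum>i\<in>UNIV. x $ i) - 1) / sqrt (real CARD('n))"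
  define T where "T = hyperplane_proj -` (W \<inter> orthant) \<inter> ?h -` {0<..<1}"
  have "open T"
    unfolding T_def using W open_orthant
    by (intro open_Int open_vimage continuous_on_hyperplane_proj continuous_intros) auto
  moreover have "p + (\<chi> i. 1 / (2 * sqrt (real CARD('n)))) \<in> T"
  proof -
    let ?x = "p + (\<chi> i. 1 / (2 * sqrt (real CARD('n))))"
    have c: "real CARD('n) / sqrt (real CARD('n)) = sqrt (real CARD('n))" by (rule real_div_sqrt) simp
    have s: "(\<Sum>i\<in>UNIV. ?x $ i) - 1 = sqrt (real CARD('n)) / 2"
      using p c by (simp add: sum.distrib simplex_interior_def)
    have proj: "hyperplane_proj ?x = p"
      unfolding hyperplane_proj_def s by (simp add: vec_eq_iff field_simps)
    have h: "?h ?x \<in> {0<..<1}"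
      unfolding s by simp
    show ?thesis
      unfolding T_def
      by (intro IntI vimageI2 h) (use p in \<open>simp_all only: proj simplex_interior_eq Int_iff\<close>)
  qed
  ultimately have "emeasure lborel T \<noteq> 0"
    using open_not_negligible[of T] by (auto simp: negligible_iff_emeasure0 emeasure_completion)
  moreover have "T \<subseteq> hyperplane_proj -` (W \<inter> simplex_interior) \<inter> slab"
    by (auto simp: T_def slab_def simplex_interior_eq sum_hyperplane_proj)
  then have "emeasure lborel T \<le> emeasure hyperplane_volume (W \<inter> simplex_interior)"
    using W by (subst emeasure_hyperplane_volume)
      (auto intro!: emeasure_mono sets.Int measurable_sets[OF hyperplane_proj_measurable, simplified])
  ultimately show ?thesis
    using zero_less_iff_neq_zero by (metis order_less_le_trans)
qed

lemma set_integral_simplex_pos: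
  fixes f :: "real^'n::finite \<Rightarrow> real"
  assumes "set_integrable hyperplane_volume simplex_interior f"
    and "\<And>p. p \<in> simplex_interior \<Longrightarrow> 0 \<le> f p"
    and W: "open W" "p \<in> W \<inter> simplex_interior"
    and pos: "\<And>p. p \<in> W \<inter> simplex_interior \<Longrightarrow> 0 < f p"
  shows "0 < (LINT p:simplex_interior|hyperplane_volume. f p)"
proof -
  let ?f = "\<lambda>p. indicator simplex_interior p *\<^sub>R f p"
  have int: "integrable hyperplane_volume ?f"
    using assms(1) by (simp add: set_integrable_def)
  have nn: "AE p in hyperplane_volume. 0 \<le> ?f p"
    by (intro AE_I2) (auto simp: indicator_def assms(2))
  have "(LINT p|hyperplane_volume. ?f p) \<noteq> 0"
  proof
    assume "(LINT p|hyperplane_volume. ?f p) = 0"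
    then have "AE p in hyperplane_volume. ?f p = 0"
      using integral_nonneg_eq_0_iff_AE[OF int nn] by simp
    then have "AE p in hyperplane_volume. p \<notin> W \<inter> simplex_interior"
      by eventually_elim (use pos in force)
    then have "emeasure hyperplane_volume (W \<inter> simplex_interior) = 0"
      using W by (subst (asm) AE_iff_measurable[OF _ refl]) (auto simp: Int_def)
    then show False
      using emeasure_hyperplane_volume_pos[OF W] by simp
  qed
  moreover have "0 \<le> (LINT p|hyperplane_volume. ?f p)"
    by (rule integral_nonneg_AE[OF nn])
  ultimately show ?thesis by (simp add: set_lebesgue_integral_def)
qed

section \<open>Integrals of tangential derivatives\<close>

text \<open>Extended by zero off the simplex, the function is dominated by a multiple of the indicator of a
compact set; this gives both integrability and the domination in the limit below.\<close>

lemma compact_support_bound: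
  assumes h: "continuous_on simplex_interior (h :: real^'n::finite \<Rightarrow> real)"
    and K: "compact K" "K \<subseteq> simplex_interior"
    and h0: "\<And>p. p \<in> simplex_interior - K \<Longrightarrow> h p = 0"
  obtains M where "0 \<le> M" "\<And>p. \<bar>indicator simplex_interior p *\<^sub>R h p\<bar> \<le> M * indicator K p"
proof -
  have "bounded (h ` K)"
    using K h by (intro compact_imp_bounded compact_continuous_image) (auto intro: continuous_on_subset)
  then obtain M where "0 < M" and M: "\<And>p. p \<in> K \<Longrightarrow> \<bar>h p\<bar> \<le> M"
    unfolding bounded_pos by auto
  show thesis
  proof
    show "0 \<le> M" using \<open>0 < M\<close> by simp
    show "\<bar>indicator simplex_interior p *\<^sub>R h p\<bar> \<le> M * indicator K p" for p
      using M[of p] h0[of p] K(2) by (auto simp: indicator_def)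
  qed
qed

lemma set_integrable_compact_support:
  assumes h: "continuous_on simplex_interior (h :: real^'n::finite \<Rightarrow> real)"
    and K: "compact K" "K \<subseteq> simplex_interior"
    and h0: "\<And>p. p \<in> simplex_interior - K \<Longrightarrow> h p = 0"
  shows "set_integrable hyperplane_volume simplex_interior h"
proof -
  obtain M where M: "\<And>p. \<bar>indicator simplex_interior p *\<^sub>R h p\<bar> \<le> M * indicator K p"
    using compact_support_bound[OF assms] by metis
  have "integrable hyperplane_volume (\<lambda>p. M * indicator K p)"
    using K emeasure_hyperplane_volume_bounded[of K]
    by (intro integrable_mult_right integrable_real_indicator)
       (auto intro: compact_imp_bounded borel_compact)
  moreover have "(\<lambda>p. indicator simplex_interior p *\<^sub>R h p) \<in> borel_measurable hyperplane_volume"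
    using borel_measurable_continuous_on_indicator[OF simplex_borel h] by simp
  ultimately show ?thesis
    unfolding set_integrable_def
    by (rule Bochner_Integration.integrable_bound) (use order_trans[OF M abs_ge_self] in simp)
qed

lemma eventually_simplex_line:
  assumes "p \<in> simplex_interior" "(\<Sum>i\<in>UNIV. v $ i) = 0"
  shows "eventually (\<lambda>t::real. p + t *\<^sub>R v \<in> simplex_interior) (nhds 0)"
proof -
  have "open ((\<lambda>t::real. p + t *\<^sub>R v) -` orthant)"
    by (intro open_vimage open_orthant continuous_intros)
  moreover have "0 \<in> (\<lambda>t::real. p + t *\<^sub>R v) -` orthant"
    using assms(1) by (simp add: simplex_interior_eq)
  ultimately have "eventually (\<lambda>t::real. p + t *\<^sub>R v \<in> orthant) (nhds 0)"
    by (auto simp: eventually_nhds)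
  then show ?thesis
    using assms by (auto simp: simplex_interior_eq sum.distrib sum_distrib_left[symmetric])
qed

text \<open>A function that is extended by zero off the simplex has a derivative in every direction
tangential to the simplex: inside it agrees with \<open>F\<close> along a short segment, and off the compact \<open>K\<close> it
vanishes along a short segment. On the overlap the two values must agree, so tangential derivatives
vanish off \<open>K\<close> although the extension of \<open>F\<close> is arbitrary off the simplex.\<close>

lemma simplex_line_derivative:
  assumes U: "open U" "simplex_interior \<subseteq> U" and F: "C_on (Suc 0) F U"
    and K: "compact K" "K \<subseteq> simplex_interior"
    and F0: "\<And>p. p \<in> simplex_interior - K \<Longrightarrow> F p = 0"
    and v: "(\<Sum>i\<in>UNIV. v $ i) = 0"
  shows "p \<in> simplex_interior - K \<Longrightarrow> frechet_derivative F (at p) v = 0"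
    and "((\<lambda>t. indicator simplex_interior (p + t *\<^sub>R v) *\<^sub>R F (p + t *\<^sub>R v)) has_real_derivative
           indicator simplex_interior p *\<^sub>R frechet_derivative F (at p) v) (at 0)"
proof -
  let ?F = "\<lambda>t. indicator simplex_interior (p + t *\<^sub>R v) *\<^sub>R F (p + t *\<^sub>R v)"
  have 1: "(?F has_real_derivative 0) (at 0)" if "p \<notin> K"
  proof -
    have "open ((\<lambda>t::real. p + t *\<^sub>R v) -` (- K))"
      using K(1) by (intro open_vimage continuous_intros open_Compl compact_imp_closed)
    moreover have "0 \<in> (\<lambda>t::real. p + t *\<^sub>R v) -` (- K)" using that by simp
    ultimately have "eventually (\<lambda>t::real. p + t *\<^sub>R v \<notin> K) (nhds 0)"
      by (auto simp: eventually_nhds)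
    then have "eventually (\<lambda>t. ?F t = 0) (nhds 0)"
    proof eventually_elim
      case (elim t)
      then show ?case using F0[of "p + t *\<^sub>R v"] by (simp add: indicator_def)
    qed
    then show ?thesis
      using DERIV_cong_ev[OF refl _ refl, of ?F "\<lambda>_. 0" 0 0] by simp
  qed
  have 2: "(?F has_real_derivative frechet_derivative F (at p) v) (at 0)" if p: "p \<in> simplex_interior"
  proof -
    have D: "(F has_derivative frechet_derivative F (at p)) (at (p + 0 *\<^sub>R v))"
      using C_on_SucD[OF U(1) F] p U(2) by auto
    have "((\<lambda>t::real. p + t *\<^sub>R v) has_derivative (\<lambda>t. t *\<^sub>R v)) (at 0)"
      by (auto intro!: derivative_eq_intros)
    from diff_chain_at[OF this D]
    have "((\<lambda>t::real. F (p + t *\<^sub>R v)) has_derivative (\<lambda>t. t * frechet_derivative F (at p) v)) (at 0)"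
      using linear_cmul[OF has_derivative_linear[OF D]] by (simp add: o_def)
    then have "((\<lambda>t::real. F (p + t *\<^sub>R v)) has_real_derivative frechet_derivative F (at p) v) (at 0)"
      by (simp add: has_field_derivative_def mult_commute_abs)
    moreover have "eventually (\<lambda>t. ?F t = F (p + t *\<^sub>R v)) (nhds 0)"
      using eventually_simplex_line[OF p v] by eventually_elim simp
    ultimately show ?thesis
      by (subst DERIV_cong_ev[OF refl _ refl])
  qed
  show *: "p \<in> simplex_interior - K \<Longrightarrow> frechet_derivative F (at p) v = 0"
    using DERIV_unique[OF 1 2] by auto
  show "(?F has_real_derivative indicator simplex_interior p *\<^sub>R frechet_derivative F (at p) v) (at 0)"
    using 1 2 K(2) by (cases "p \<in> simplex_interior") auto
qed

text \<open>Let \<open>G\<close> be \<open>F\<close> extended by zero. The difference quotients of \<open>G\<close> in the tangential direction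
\<open>v = e\<^sub>i - e\<^sub>k\<close> have integral zero by translation invariance. They converge to the derivative, and by
the mean value theorem they are bounded by a constant on a fixed compact set, so dominated convergence
applies.\<close>

lemma integral_tangential_derivative:
  fixes F :: "real^'n::finite \<Rightarrow> real"
  assumes U: "open U" "simplex_interior \<subseteq> U" and F: "C_on (Suc 0) F U"
    and K: "compact K" "K \<subseteq> simplex_interior"
    and F0: "\<And>p. p \<in> simplex_interior - K \<Longrightarrow> F p = 0"
  shows "set_integrable hyperplane_volume simplex_interior (\<lambda>p. pderiv_at i F p - pderiv_at k F p)"
    and "(LINT p:simplex_interior|hyperplane_volume. pderiv_at i F p - pderiv_at k F p) = 0"
proof -
  define v :: "real^'n" where "v = axis i 1 - axis k 1"
  have v: "(\<Sum>i\<in>UNIV. v $ i) = 0"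
    by (simp add: v_def sum_subtractf axis_def)
  define f where "f p = pderiv_at i F p - pderiv_at k F p" for p
  define G where "G p = indicator simplex_interior p *\<^sub>R F p" for p
  define D where "D p = indicator simplex_interior p *\<^sub>R f p" for p
  have f: "frechet_derivative F (at p) v = f p" if "p \<in> simplex_interior" for p
    using has_derivative_linear[OF C_on_SucD[OF U(1) F]] that U(2)
    by (auto simp: f_def v_def pderiv_at_def linear_diff)
  have cont: "continuous_on simplex_interior f"
    using C_on_pderiv[OF F] U(2)
    unfolding f_def by (intro continuous_intros) (auto intro: continuous_on_subset)
  have f0: "f p = 0" if "p \<in> simplex_interior - K" for p
    using simplex_line_derivative(1)[OF assms v that] f that by simp
  have deriv0: "((\<lambda>t. G (p + t *\<^sub>R v)) has_real_derivative D p) (at 0)" for p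
    using simplex_line_derivative(2)[OF assms v, of p] f[of p]
    unfolding G_def D_def by (cases "p \<in> simplex_interior") auto
  have deriv: "((\<lambda>t. G (p + t *\<^sub>R v)) has_real_derivative D (p + t *\<^sub>R v)) (at t)" for p t
    using deriv0[of "p + t *\<^sub>R v"] DERIV_at_within_shift[of "\<lambda>t. G (p + t *\<^sub>R v)" "D (p + t *\<^sub>R v)" t 0 UNIV]
    by (simp add: algebra_simps)
  obtain M where M: "0 \<le> M" "\<And>p. \<bar>D p\<bar> \<le> M * indicator K p"
    using compact_support_bound[OF cont K f0] unfolding D_def by metis
  have M': "\<bar>D p\<bar> \<le> M" for p
    using M(1) M(2)[of p] by (cases "p \<in> K") auto
  have lip: "\<bar>G (p + t *\<^sub>R v) - G p\<bar> \<le> M * \<bar>t\<bar>" for p t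
    using field_differentiable_bound[of UNIV "\<lambda>t. G (p + t *\<^sub>R v)" "\<lambda>t. D (p + t *\<^sub>R v)" M t 0] deriv M'
    by auto
  \<comment> \<open>Every quotient with step in \<open>[0, 1]\<close> is supported in the set that \<open>K\<close> sweeps out when moved along \<open>- v\<close>.\<close>
  define K' where "K' = (\<lambda>(q, t). q - t *\<^sub>R v) ` (K \<times> {0..1})"
  have K': "compact K'"
    unfolding K'_def using K(1)
    by (intro compact_continuous_image compact_Times) (auto simp: case_prod_unfold intro!: continuous_intros)
  have G0: "G p = 0" if "p \<notin> K" for p
    using F0[of p] that by (auto simp: G_def indicator_def)
  have bound: "\<bar>G (p + t *\<^sub>R v) - G p\<bar> \<le> M * \<bar>t\<bar> * indicator K' p" if "t \<in> {0..1}" for p t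
  proof (cases "p \<in> K'")
    case False
    have "p + s *\<^sub>R v \<notin> K" if "s \<in> {0..1}" for s
    proof
      assume "p + s *\<^sub>R v \<in> K"
      then have "(\<lambda>(q, t). q - t *\<^sub>R v) (p + s *\<^sub>R v, s) \<in> K'"
        unfolding K'_def using that by (intro imageI) auto
      then show False using False by simp
    qed
    from this[of 0] this[of t] show ?thesis
      using that False by (simp add: G0)
  qed (use lip in simp)
  have intG: "integrable hyperplane_volume G"
    unfolding G_def set_integrable_def[symmetric]
    using C_on_continuous_on[OF F] U(2) K F0
    by (intro set_integrable_compact_support[of F K]) (auto intro: continuous_on_subset)
  have [measurable]: "G \<in> borel_measurable borel" "D \<in> borel_measurable borel"
    using borel_measurable_integrable[OF intG] borel_measurable_continuous_on_indicator[OF simplex_borel cont]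
    by (simp_all add: D_def[abs_def])
  define q where "q m p = (G (p + inverse (Suc m) *\<^sub>R v) - G p) / inverse (Suc m)" for m :: nat and p
  have q_int: "(LINT p|hyperplane_volume. q m p) = 0" for m
  proof -
    have v': "(\<Sum>i\<in>UNIV. (inverse (Suc m) *\<^sub>R v) $ i) = 0"
      using v by (simp add: sum_distrib_left[symmetric])
    show ?thesis
      unfolding q_def
      using integrable_hyperplane_volume_translate[OF v' intG] intG
        integral_hyperplane_volume_translate[OF v', of G]
      by simp
  qed
  have q_lim: "(\<lambda>m. q m p) \<longlonglongrightarrow> D p" for p
  proof -
    have "((\<lambda>t. (G (p + t *\<^sub>R v) - G p) / t) \<longlongrightarrow> D p) (at 0)"
      using deriv0[of p] by (simp add: DERIV_def)
    moreover have "filterlim (\<lambda>m. inverse (real (Suc m))) (at 0) sequentially"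
      using LIMSEQ_inverse_real_of_nat by (auto simp: filterlim_at)
    ultimately show ?thesis
      unfolding q_def by (rule filterlim_compose)
  qed
  have q_bound: "norm (q m p) \<le> M * indicator K' p" for m p
  proof -
    have "\<bar>G (p + inverse (Suc m) *\<^sub>R v) - G p\<bar> \<le> M * inverse (Suc m) * indicator K' p"
      using bound[of "inverse (Suc m)" p] by (simp add: inverse_le_1_iff)
    then have "\<bar>G (p + inverse (Suc m) *\<^sub>R v) - G p\<bar> \<le> M * indicator K' p * inverse (Suc m)"
      by (simp only: mult_ac)
    moreover have "norm (q m p) = \<bar>G (p + inverse (Suc m) *\<^sub>R v) - G p\<bar> / inverse (Suc m)"
      unfolding q_def real_norm_def abs_divide by (simp only: abs_inverse abs_of_nat)
    ultimately show ?thesis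
      by (simp only: pos_divide_le_eq positive_imp_inverse_positive of_nat_0_less_iff zero_less_Suc)
  qed
  have w: "integrable hyperplane_volume (\<lambda>p. M * indicator K' p)"
    using K' emeasure_hyperplane_volume_bounded[of K']
    by (intro integrable_mult_right integrable_real_indicator)
       (auto intro: compact_imp_bounded borel_compact)
  have qm: "q m \<in> borel_measurable hyperplane_volume" for m
    unfolding q_def by measurable
  have "(\<lambda>m. LINT p|hyperplane_volume. q m p) \<longlonglongrightarrow> (LINT p|hyperplane_volume. D p)"
    by (rule integral_dominated_convergence[OF _ qm w]) (simp_all add: q_lim q_bound[simplified])
  then have "(LINT p|hyperplane_volume. D p) = 0"
    unfolding q_int using LIMSEQ_unique[OF tendsto_const] by metis
  then show "(LINT p:simplex_interior|hyperplane_volume. pderiv_at i F p - pderiv_at k F p) = 0"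
    by (simp add: D_def f_def set_lebesgue_integral_def)
  show "set_integrable hyperplane_volume simplex_interior (\<lambda>p. pderiv_at i F p - pderiv_at k F p)"
    using set_integrable_compact_support[OF cont K f0] by (simp add: f_def)
qed

section \<open>Test functions determine continuous functions\<close>

text \<open>Powers of the positive part provide the bump functions of class \<open>C\<^sup>2\<close>.\<close>

lemma has_real_derivative_pos_part_power:
  "((\<lambda>u::real. max u 0 ^ (k + 2)) has_real_derivative real (k + 2) * max u 0 ^ (k + 1)) (at u)"
proof -
  consider "u > 0" | "u < 0" | "u = 0" by linarith
  then show ?thesis
  proof cases
    case 1
    have "((\<lambda>u::real. u ^ (k + 2)) has_real_derivative real (k + 2) * u ^ (k + 1)) (at u)"
      using DERIV_pow[of "k + 2" u UNIV] by simp
    then show ?thesis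
      using 1 by (subst DERIV_cong_ev[OF refl _ refl, where g = "\<lambda>u. u ^ (k + 2)"])
        (auto simp: eventually_nhds intro!: exI[of _ "{0<..}"])
  next
    case 2
    then have "eventually (\<lambda>u::real. max u 0 ^ (k + 2) = 0) (nhds u)"
      by (auto simp: eventually_nhds intro!: exI[of _ "{..<0}"])
    then show ?thesis
      using 2 DERIV_cong_ev[OF refl _ refl, of "\<lambda>u. max u 0 ^ (k + 2)" "\<lambda>_. 0" u 0] by simp
  next
    case 3
    have "((\<lambda>h::real. max h 0 ^ (k + 2) / h) \<longlongrightarrow> 0) (at 0)"
    proof (rule Lim_null_comparison)
      show "\<forall>\<^sub>F h::real in at 0. norm (max h 0 ^ (k + 2) / h) \<le> \<bar>h\<bar> ^ (k + 1)"
      proof (intro always_eventually allI)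
        fix h :: real
        show "norm (max h 0 ^ (k + 2) / h) \<le> \<bar>h\<bar> ^ (k + 1)"
          by (cases "0 < h") (simp_all add: max_def del: power_Suc, simp)
      qed
      have "((\<lambda>h::real. \<bar>h\<bar> ^ (k + 1)) \<longlongrightarrow> \<bar>0\<bar> ^ (k + 1)) (at 0)"
        by (intro tendsto_intros)
      then show "((\<lambda>h::real. \<bar>h\<bar> ^ (k + 1)) \<longlongrightarrow> 0) (at 0)" by simp
    qed
    then show ?thesis
      using 3 by (simp add: DERIV_def)
  qed
qed

lemma C_on_pos_part_power: "C_on k (\<lambda>u::real. max u 0 ^ (k + 1)) UNIV"
proof (induction k)
  case 0
  show ?case by (auto intro!: continuous_intros)
next
  case (Suc k)
  have "C_on (Suc k) (\<lambda>u::real. max u 0 ^ (k + 2)) UNIV"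
    by (rule C_on_Suc_real[OF open_UNIV has_real_derivative_pos_part_power]) (intro C_on_cmult Suc open_UNIV)
  then show ?case by simp
qed

lemma C_on_norm_sq: "C_on k (\<lambda>x::real^'n. (norm (x - p))\<^sup>2) UNIV"
proof -
  have "(\<lambda>x. (norm (x - p))\<^sup>2) = (\<lambda>x. \<Sum>i\<in>UNIV. (x $ i - p $ i) * (x $ i - p $ i))"
    by (auto simp: power2_norm_eq_inner inner_vec_def)
  then show ?thesis
    by (simp only:) (intro C_on_sum C_on_mult C_on_diff C_on_nth C_on_const open_UNIV)
qed

lemma bump_test_function:
  assumes p: "p \<in> simplex_interior" and e: "0 < e"
  obtains r where "0 < r" "r \<le> e"
    "test_function (\<lambda>x. max (r\<^sup>2 - (norm (x - p))\<^sup>2) 0 ^ 3)"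
proof -
  obtain d where d: "0 < d" "cball p d \<subseteq> orthant"
    using p open_orthant open_contains_cball simplex_subset_orthant by (metis subsetD)
  define r where "r = min d e"
  have r: "0 < r" "r \<le> e" "cball p r \<subseteq> orthant"
    using d e by (auto simp: r_def)
  define K where "K = cball p r \<inter> {x. (\<Sum>i\<in>UNIV. x $ i) = 1}"
  have "compact K"
    unfolding K_def by (intro compact_Int_closed compact_cball closed_Collect_eq continuous_intros)
  moreover have "K \<subseteq> simplex_interior"
    using r(3) by (auto simp: K_def simplex_interior_eq)
  moreover have "max (r\<^sup>2 - (norm (x - p))\<^sup>2) 0 ^ 3 = 0" if "x \<in> simplex_interior - K" for x
  proof -
    have "r \<le> norm (x - p)"
      using that by (auto simp: K_def simplex_interior_eq dist_norm norm_minus_commute)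
    then have "r\<^sup>2 \<le> (norm (x - p))\<^sup>2" using r(1) by (intro power_mono) auto
    then show ?thesis by simp
  qed
  moreover have "C_simplex 2 (\<lambda>x. max (r\<^sup>2 - (norm (x - p))\<^sup>2) 0 ^ 3)"
  proof -
    have "C_on 2 (\<lambda>u::real. max u 0 ^ 3) UNIV"
      using C_on_pos_part_power[of 2] by simp
    then have "C_on 2 (\<lambda>x. max (r\<^sup>2 - (norm (x - p))\<^sup>2) 0 ^ 3) UNIV"
      by (rule C_on_compose_real[OF open_UNIV open_UNIV])
        (simp, intro C_on_diff C_on_const C_on_norm_sq open_UNIV)
    then show ?thesis unfolding C_simplex_def by (intro exI[of _ UNIV]) auto
  qed
  ultimately have "test_function (\<lambda>x. max (r\<^sup>2 - (norm (x - p))\<^sup>2) 0 ^ 3)"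
    unfolding test_function_def by blast
  with r show thesis using that by blast
qed

text \<open>If \<open>h\<close> did not vanish at \<open>p\<close>, it would have constant sign near \<open>p\<close>, and a bump function
supported there would have a nonzero integral against it.\<close>

lemma test_functions_separate:
  fixes h :: "real^'n::finite \<Rightarrow> real"
  assumes cont: "continuous_on simplex_interior h"
    and int: "\<And>\<Phi>. test_function \<Phi> \<Longrightarrow> set_integrable hyperplane_volume simplex_interior (\<lambda>p. \<Phi> p * h p)"
    and zero: "\<And>\<Phi>. test_function \<Phi> \<Longrightarrow> (LINT p:simplex_interior|hyperplane_volume. \<Phi> p * h p) = 0"
    and p: "p \<in> simplex_interior"
  shows "h p = 0"
proof (rule ccontr)
  assume "h p \<noteq> 0"
  then obtain e where e: "0 < e" and he: "\<And>x. x \<in> simplex_interior \<Longrightarrow> dist x p < e \<Longrightarrow> dist (h x) (h p) < \<bar>h p\<bar>"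
    using cont p unfolding continuous_on_iff by (metis zero_less_abs_iff)
  obtain r where r: "0 < r" "r \<le> e" and test: "test_function (\<lambda>x. max (r\<^sup>2 - (norm (x - p))\<^sup>2) 0 ^ 3)"
    using bump_test_function[OF p e] .
  define \<Phi> where "\<Phi> x = max (r\<^sup>2 - (norm (x - p))\<^sup>2) 0 ^ 3" for x
  have test: "test_function \<Phi>" using test by (simp add: \<Phi>_def[abs_def])
  define s where "s = sgn (h p)"
  have s: "0 < s * h x" if "x \<in> simplex_interior" "dist x p < r" for x
    using he[of x] that r \<open>h p \<noteq> 0\<close> by (auto simp: s_def sgn_if dist_real_def)
  have pos: "0 < \<Phi> x" if "x \<in> ball p r" for x
  proof -
    have "(norm (x - p))\<^sup>2 < r\<^sup>2"
      using that by (intro power_strict_mono) (auto simp: dist_norm norm_minus_commute)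
    then show ?thesis by (simp add: \<Phi>_def)
  qed
  have zr: "\<Phi> x = 0" if "x \<notin> ball p r" for x
  proof -
    have "r\<^sup>2 \<le> (norm (x - p))\<^sup>2"
      using that r(1) by (intro power_mono) (auto simp: dist_norm norm_minus_commute)
    then show ?thesis by (simp add: \<Phi>_def)
  qed
  have "0 < (LINT x:simplex_interior|hyperplane_volume. s * (\<Phi> x * h x))"
  proof (rule set_integral_simplex_pos)
    show "set_integrable hyperplane_volume simplex_interior (\<lambda>x. s * (\<Phi> x * h x))"
      using int[OF test] by (rule set_integrable_mult_right)
    show "open (ball p r)" "p \<in> ball p r \<inter> simplex_interior" using p r by auto
    show p: "0 < s * (\<Phi> x * h x)" if "x \<in> ball p r \<inter> simplex_interior" for x
      using mult_pos_pos[OF pos[of x] s[of x]] that by (auto simp: dist_commute mult_ac)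
    show "0 \<le> s * (\<Phi> x * h x)" if "x \<in> simplex_interior" for x
      using p[of x] zr[of x] that by (cases "x \<in> ball p r") auto
  qed
  then show False using zero[OF test] by (simp add: set_integral_mult_right)
qed

section \<open>Eigenvalues of symmetric matrices\<close>

text \<open>A maximizer \<open>v\<close> of the quadratic form on the unit sphere of \<open>S\<close> is an eigenvector: with \<open>l\<close> the
maximum, \<open>l |y|\<^sup>2 - y \<bullet> f y\<close> is nonnegative on \<open>S\<close> and vanishes at \<open>v\<close>, so its derivative
at \<open>v\<close> vanishes in all directions of \<open>S\<close>.\<close>

lemma self_adjoint_eigenvector:
  fixes f :: "'a::euclidean_space \<Rightarrow> 'a"
  assumes f: "linear f" and S: "subspace S" "S \<noteq> {0}" and inv: "\<And>x. x \<in> S \<Longrightarrow> f x \<in> S"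
    and adj: "\<And>x y. f x \<bullet> y = x \<bullet> f y"
  obtains v l where "v \<in> S" "norm v = 1" "f v = l *\<^sub>R v"
proof -
  interpret linear f by fact
  define T where "T = S \<inter> sphere 0 1"
  obtain x where x: "x \<in> S" "x \<noteq> 0" using S subspace_0 by blast
  then have "x /\<^sub>R norm x \<in> T"
    using S(1) by (auto simp: T_def subspace_scale)
  moreover have "compact T"
    unfolding T_def using closed_subspace[OF S(1)] by (metis Int_commute compact_Int_closed compact_sphere)
  moreover have "continuous_on T (\<lambda>x. x \<bullet> f x)"
    using f by (intro continuous_intros linear_continuous_on linear_conv_bounded_linear[THEN iffD1])
  ultimately obtain v where v: "v \<in> T" and max: "\<And>y. y \<in> T \<Longrightarrow> y \<bullet> f y \<le> v \<bullet> f v"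
    using continuous_attains_sup[of T "\<lambda>x. x \<bullet> f x"] by blast
  define l where "l = v \<bullet> f v"
  have vv: "v \<bullet> v = 1" "v \<in> S" "norm v = 1" using v by (auto simp: T_def norm_eq_1)
  have nonneg: "0 \<le> l * (y \<bullet> y) - y \<bullet> f y" if "y \<in> S" for y
  proof (cases "y = 0")
    case False
    then have "y /\<^sub>R norm y \<in> T"
      using that S(1) by (auto simp: T_def subspace_scale)
    from max[OF this] have "y \<bullet> f y / (norm y)\<^sup>2 \<le> l"
      by (simp add: l_def scale power2_eq_square divide_inverse mult_ac)
    then show ?thesis
      using False by (simp add: divide_le_eq power2_norm_eq_inner)
  qed (simp add: zero)
  have "l * (v \<bullet> w) - f v \<bullet> w = 0" if w: "w \<in> S" for w
  proof (rule ccontr)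
    define a where "a = l * (v \<bullet> w) - f v \<bullet> w"
    define b where "b = l * (w \<bullet> w) - w \<bullet> f w"
    assume "l * (v \<bullet> w) - f v \<bullet> w \<noteq> 0"
    then have a: "a \<noteq> 0" by (simp add: a_def)
    have b: "0 \<le> b" using nonneg[OF w] by (simp add: b_def)
    have "0 \<le> 2 * t * a + t\<^sup>2 * b" for t
    proof -
      have "v + t *\<^sub>R w \<in> S" using S(1) vv w by (intro subspace_add subspace_scale)
      from nonneg[OF this] show ?thesis
        by (simp add: a_def b_def add scale inner_add_left inner_add_right l_def[symmetric] vv(1)
            adj[of v w, symmetric] inner_commute[of w v] inner_commute[of w "f v"]
            algebra_simps power2_eq_square)
    qed
    \<comment> \<open>A quadratic in \<open>t\<close> with zero constant term is negative for small \<open>t\<close> of sign opposite to \<open>a\<close>.\<close>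
    note quadratic = this
    define c where "c = 1 / (b + 1)"
    have c: "0 < c" "c * b < 1" using b by (auto simp: c_def)
    have "0 \<le> (a\<^sup>2 * c) * (c * b - 2)"
      using quadratic[of "- a * c"] by (simp add: algebra_simps power2_eq_square)
    moreover have "(a\<^sup>2 * c) * (c * b - 2) < 0"
      using a c by (intro mult_pos_neg) auto
    ultimately show False by linarith
  qed
  then have "(l *\<^sub>R v - f v) \<bullet> (l *\<^sub>R v - f v) = 0"
    using S(1) vv inv by (metis inner_diff_left inner_scaleR_left subspace_diff subspace_scale)
  then have "f v = l *\<^sub>R v" by simp
  with vv show thesis using that by blast
qed

text \<open>The orthogonal complement of an eigenvector in \<open>S\<close> is again invariant, so induction on the
dimension applies.\<close>

lemma self_adjoint_eigenbasis:
  fixes f :: "'a::euclidean_space \<Rightarrow> 'a"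
  assumes f: "linear f" and adj: "\<And>x y. f x \<bullet> y = x \<bullet> f y"
    and "subspace S" "\<And>x. x \<in> S \<Longrightarrow> f x \<in> S"
  shows "\<exists>B. B \<subseteq> S \<and> pairwise orthogonal B \<and> (\<forall>b\<in>B. norm b = 1) \<and> span B = S \<and>
    (\<forall>b\<in>B. \<exists>l. f b = l *\<^sub>R b)"
  using assms(3,4)
proof (induction "dim S" arbitrary: S rule: less_induct)
  case less
  show ?case
  proof (cases "S = {0}")
    case True
    then show ?thesis by (intro exI[of _ "{}"]) auto
  next
    case False
    obtain v l where v: "v \<in> S" "norm v = 1" "f v = l *\<^sub>R v"
      using self_adjoint_eigenvector[OF f less.prems(1) False less.prems(2) adj] by blast
    define T where "T = {x \<in> S. v \<bullet> x = 0}"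
    have T: "subspace T"
      using less.prems(1) by (auto simp: T_def subspace_def inner_add_right)
    have "v \<in> S - T" using v by (auto simp: T_def norm_eq_1)
    moreover have "T \<subseteq> S" by (auto simp: T_def)
    ultimately have "T \<subset> S" by blast
    then have "dim T < dim S"
      using T less.prems(1) by (intro dim_psubset) (metis span_eq_iff)
    moreover have "f x \<in> T" if "x \<in> T" for x
      using that less.prems(2) v(3) by (auto simp: T_def adj[symmetric])
    ultimately obtain B where B: "B \<subseteq> T" "pairwise orthogonal B" "\<forall>b\<in>B. norm b = 1" "span B = T"
        "\<forall>b\<in>B. \<exists>l. f b = l *\<^sub>R b"
      using less.hyps[OF _ T] by blast
    have "span (insert v B) = S"
    proof
      show "span (insert v B) \<subseteq> S"
        using B(1) v(1) less.prems(1) by (intro span_minimal) (auto simp: T_def)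
      show "S \<subseteq> span (insert v B)"
      proof
        fix x assume "x \<in> S"
        then have "x - (v \<bullet> x) *\<^sub>R v \<in> T"
          using v less.prems(1)
          by (auto simp: T_def subspace_diff subspace_scale inner_diff_right norm_eq_1)
        then show "x \<in> span (insert v B)"
          by (subst span_insert) (auto simp: B(4))
      qed
    qed
    moreover have "pairwise orthogonal (insert v B)"
      using B by (auto simp: pairwise_insert T_def orthogonal_def inner_commute)
    ultimately show ?thesis
      using B v by (intro exI[of _ "insert v B"]) (auto simp: T_def)
  qed
qed

lemma det_orthonormal_eigenbasis:
  fixes M :: "real^'n::finite^'n"
  assumes B: "pairwise orthogonal B" "\<And>b. b \<in> B \<Longrightarrow> norm b = 1" "span B = UNIV"
    and m: "\<And>b. b \<in> B \<Longrightarrow> M *v b = m b *\<^sub>R b"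
  shows "det M = (\<Prod>b\<in>B. m b)"
proof -
  have ind: "independent B"
    using B B(2)[of 0] by (intro pairwise_orthogonal_independent) auto
  then have "card B = CARD('n)"
    using B(3) dim_eq_card[of B UNIV] by (simp add: dim_UNIV)
  then obtain c :: "'n \<Rightarrow> real^'n" where c: "bij_betw c UNIV B"
    using finite_same_card_bij[of "UNIV::'n set" B] independent_imp_finite[OF ind] by auto
  then have cB: "c j \<in> B" for j by (auto simp: bij_betw_def)
  define Q where "Q = (\<chi> i j. c j $ i)"
  define D :: "real^'n^'n" where "D = (\<chi> i j. if i = j then m (c j) else 0)"
  have cc: "c i \<bullet> c j = (if i = j then 1 else 0)" for i j
  proof (cases "i = j")
    case True
    then show ?thesis using B(2)[OF cB[of i]] by (simp add: norm_eq_1)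
  next
    case False
    then have "c i \<noteq> c j" using c by (auto simp: bij_betw_def inj_on_def)
    then show ?thesis using B(1) cB False by (auto simp: pairwise_def orthogonal_def)
  qed
  have "transpose Q ** Q = mat 1"
    using cc by (simp add: vec_eq_iff matrix_matrix_mult_def Q_def transpose_def mat_def inner_vec_def)
  then have "det (transpose Q) * det Q = 1"
    by (metis det_I det_mul)
  then have Q: "det Q \<noteq> 0" by auto
  have "(M ** Q) $ i $ j = (Q ** D) $ i $ j" for i j
  proof -
    have "(M ** Q) $ i $ j = (M *v c j) $ i"
      by (simp add: matrix_matrix_mult_def matrix_vector_mult_def Q_def)
    also have "\<dots> = (Q ** D) $ i $ j"
      by (simp add: m[OF cB] matrix_matrix_mult_def Q_def D_def if_distrib if_distribR cong: if_cong)
    finally show ?thesis .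
  qed
  then have "M ** Q = Q ** D" by (simp add: vec_eq_iff)
  then have "det M * det Q = det Q * det D" by (metis det_mul)
  then have "det M = det D" using Q by simp
  also have "\<dots> = (\<Prod>j\<in>UNIV. m (c j))"
    by (subst det_diagonal) (auto simp: D_def)
  also have "\<dots> = (\<Prod>b\<in>B. m b)"
    using prod.reindex_bij_betw[OF c] .
  finally show ?thesis .
qed

text \<open>Take an orthonormal eigenbasis of the vectors with coordinate sum zero and complete it by the
normalized constant vector. The summand with constant entries annihilates the former and fixes the
latter, so the determinant is the product of the eigenvalues on the former, which are exactly the
positive eigenvalues with multiplicity.\<close>

lemma eigenvalue_product_eq_det:
  fixes A :: "real^'n::finite^'n"
  assumes sym: "\<And>i j. A $ i $ j = A $ j $ i" and ker: "A *v (\<chi> i. 1) = 0"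
    and pos: "\<And>x. x \<bullet> (\<chi> i. 1) = 0 \<Longrightarrow> x \<noteq> 0 \<Longrightarrow> 0 < x \<bullet> (A *v x)"
  shows "(\<Prod>l\<in>pos_eigenvalues A. l ^ dim (eigenspace A l)) =
    det (A + (\<chi> i j. 1 / real CARD('n)))"
proof -
  define e :: "real^'n" where "e = (\<chi> i. 1)"
  have e: "A *v e = 0" using ker by (simp add: e_def)
  have "transpose A = A" using sym by (simp add: transpose_def vec_eq_iff)
  then have adj: "(A *v x) \<bullet> y = x \<bullet> (A *v y)" for x y
    by (metis dot_lmul_matrix vector_transpose_matrix)
  define S where "S = {x. x \<bullet> e = 0}"
  have S: "subspace S" by (auto simp: S_def subspace_def inner_add_left)
  have "A *v x \<in> S" for x by (simp add: S_def adj e)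
  then obtain B where B: "B \<subseteq> S" "pairwise orthogonal B" "\<And>b. b \<in> B \<Longrightarrow> norm b = 1" "span B = S"
    and "\<forall>b\<in>B. \<exists>l. A *v b = l *\<^sub>R b"
    using self_adjoint_eigenbasis[OF matrix_vector_mul_linear adj S] by blast
  then obtain l where l: "\<And>b. b \<in> B \<Longrightarrow> A *v b = l b *\<^sub>R b" by metis
  have nz: "b \<noteq> 0" if "b \<in> B" for b using B(3)[OF that] by auto
  have indep: "independent X" if "X \<subseteq> B" for X
    using B(2) nz that by (intro pairwise_orthogonal_independent) (auto intro: pairwise_subset)
  have fin: "finite B" using indep[of B] independent_imp_finite by auto
  have lpos: "0 < l b" if "b \<in> B" for b
    using pos[of b] B(1,3) nz that l[OF that] by (auto simp: S_def e_def norm_eq_1)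
  have eigen: "v \<in> span {b \<in> B. l b = r}" if "0 < r" "A *v v = r *\<^sub>R v" for r v
  proof -
    have "r * (v \<bullet> e) = v \<bullet> (A *v e)"
      using adj[of v e] that by simp
    then have "v \<in> span B" using that e B(4) by (simp add: S_def)
    then have v: "v = (\<Sum>b\<in>B. (v \<bullet> b) *\<^sub>R b)"
      using orthonormal_basis_expand[OF B(2) B(3) _ fin] by metis
    have "v \<bullet> b = 0" if b: "b \<in> B" "l b \<noteq> r" for b
      using adj[of v b] \<open>A *v v = r *\<^sub>R v\<close> l[OF b(1)] b(2) by simp
    then have "(v \<bullet> b) *\<^sub>R b \<in> span {b \<in> B. l b = r}" if "b \<in> B" for b
      using that by (cases "l b = r") (auto intro: span_scale span_base span_zero)
    then show ?thesis by (subst v) (intro span_sum)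
  qed
  have esp: "eigenspace A r = span {b \<in> B. l b = r}" if "0 < r" for r
  proof
    show "eigenspace A r \<subseteq> span {b \<in> B. l b = r}"
      using eigen[OF that] by (auto simp: eigenspace_def)
    show "span {b \<in> B. l b = r} \<subseteq> eigenspace A r"
      by (rule span_minimal)
         (auto simp: eigenspace_def l subspace_def matrix_vector_right_distrib scaleR_right_distrib
           matrix_vector_mult_scaleR)
  qed
  have pe: "pos_eigenvalues A = l ` B"
  proof
    show "l ` B \<subseteq> pos_eigenvalues A"
      using lpos l nz by (auto simp: pos_eigenvalues_def)
    show "pos_eigenvalues A \<subseteq> l ` B"
    proof
      fix r assume "r \<in> pos_eigenvalues A"
      then obtain v where "0 < r" "v \<noteq> 0" "A *v v = r *\<^sub>R v" by (auto simp: pos_eigenvalues_def)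
      with eigen[of r v] have "{b \<in> B. l b = r} \<noteq> {}" by (metis span_empty singletonD)
      then show "r \<in> l ` B" by auto
    qed
  qed
  have "(\<Prod>r\<in>pos_eigenvalues A. r ^ dim (eigenspace A r)) = (\<Prod>r\<in>l ` B. \<Prod>b\<in>{b \<in> B. l b = r}. l b)"
    unfolding pe
  proof (rule prod.cong[OF refl])
    fix r assume "r \<in> l ` B"
    then have "dim (eigenspace A r) = card {b \<in> B. l b = r}"
      using esp lpos indep[of "{b \<in> B. l b = r}"] by (auto simp: dim_eq_card_independent)
    then show "r ^ dim (eigenspace A r) = (\<Prod>b\<in>{b \<in> B. l b = r}. l b)" by simp
  qed
  also have "\<dots> = (\<Prod>b\<in>B. l b)"
    by (rule prod.group) (use fin in auto)
  finally have 1: "(\<Prod>r\<in>pos_eigenvalues A. r ^ dim (eigenspace A r)) = (\<Prod>b\<in>B. l b)" .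

  define u where "u = e /\<^sub>R norm e"
  have ee: "e \<bullet> e = real CARD('n)" by (simp add: e_def inner_vec_def)
  then have "e \<noteq> 0" by auto
  then have u: "norm u = 1" by (simp add: u_def)
  have "u \<notin> S" using \<open>e \<noteq> 0\<close> by (simp add: u_def S_def)
  then have uB: "u \<notin> B" using B(1) by auto
  let ?M = "A + (\<chi> i j. 1 / real CARD('n))"
  have M: "?M *v x = A *v x + ((x \<bullet> e) / real CARD('n)) *\<^sub>R e" for x
    by (simp add: matrix_vector_mult_add_rdistrib)
       (simp add: vec_eq_iff matrix_vector_mult_def e_def inner_vec_def sum_divide_distrib)
  have "span (insert u B) = UNIV"
  proof -
    have "x \<in> span (insert u B)" for x
    proof -
      have "x - ((x \<bullet> e) / (e \<bullet> e)) *\<^sub>R e \<in> span B"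
        using \<open>e \<noteq> 0\<close> by (simp add: B(4) S_def inner_diff_left)
      also have "((x \<bullet> e) / (e \<bullet> e)) *\<^sub>R e = ((x \<bullet> e) / (e \<bullet> e) * norm e) *\<^sub>R u"
        using \<open>e \<noteq> 0\<close> by (simp add: u_def)
      finally show ?thesis unfolding span_insert by blast
    qed
    then show ?thesis by auto
  qed
  moreover have "pairwise orthogonal (insert u B)"
    using B(1,2) by (auto simp: pairwise_insert orthogonal_def S_def u_def inner_commute)
  ultimately have "det ?M = (\<Prod>b\<in>insert u B. if b = u then 1 else l b)"
  proof (intro det_orthonormal_eigenbasis)
    fix b assume b: "b \<in> insert u B"
    show "norm b = 1" using b B(3) u by auto
    show "?M *v b = (if b = u then 1 else l b) *\<^sub>R b"
    proof (cases "b = u")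
      case True
      have "u \<bullet> e / real CARD('n) = inverse (norm e)" using ee by (simp add: u_def)
      then show ?thesis
        using True by (simp add: M) (simp add: u_def e matrix_vector_mult_scaleR)
    next
      case False
      then show ?thesis using b B(1) l by (auto simp: M S_def)
    qed
  qed
  also have "\<dots> = (\<Prod>b\<in>B. if b = u then 1 else l b)"
    using uB fin by simp
  also have "\<dots> = (\<Prod>b\<in>B. l b)"
    using uB by (intro prod.cong) auto
  finally show ?thesis using 1 by simp
qed

section \<open>The Laplacian matrix of a weighted graph\<close>

locale weighted_simplex =
  fixes E :: "('n::finite \<times> 'n) set" and \<omega> :: "real^'n^'n" and \<theta> :: "real \<Rightarrow> real \<Rightarrow> real"
  assumes graph: "weighted_graph E \<omega>" and avg: "average_function \<theta>"
begin

abbreviation L :: "real^'n \<Rightarrow> real^'n^'n" where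
  "L \<equiv> laplacian E \<omega> \<theta>"

text \<open>The off-diagonal entries of \<open>- L\<close>. They vanish identically for non-adjacent vertices, which allows
sums over neighbours to be extended to all vertices.\<close>

definition conductance :: "'n \<Rightarrow> 'n \<Rightarrow> real^'n \<Rightarrow> real" where
  "conductance i j p = \<omega> $ i $ j * edge_theta E \<omega> \<theta> i j p"

lemma edge_sym: "(i, j) \<in> E \<Longrightarrow> (j, i) \<in> E"
  using graph by (auto simp: weighted_graph_def dest: symD)

lemma no_loop: "(i, i) \<notin> E"
  using graph by (auto simp: weighted_graph_def irrefl_def)

lemma weight_pos: "(i, j) \<in> E \<Longrightarrow> 0 < \<omega> $ i $ j"
  and weight_nonedge: "(i, j) \<notin> E \<Longrightarrow> \<omega> $ i $ j = 0"
  using graph unfolding weighted_graph_def by metis+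

lemma weight_sym: "\<omega> $ i $ j = \<omega> $ j $ i"
  using graph unfolding weighted_graph_def by metis

lemma vertex_weight_pos:
  assumes "(i, j) \<in> E" shows "0 < vertex_weight E \<omega> i"
proof -
  have "0 < (\<Sum>j\<in>nbrs E i. \<omega> $ i $ j)"
    using assms by (intro sum_pos) (auto simp: nbrs_def weight_pos)
  moreover have "0 < (\<Sum>(k, l)\<in>E. \<omega> $ k $ l)"
    using assms by (intro sum_pos) (auto simp: weight_pos)
  ultimately show ?thesis by (simp add: vertex_weight_def)
qed

lemma edge_theta_pos:
  assumes "(i, j) \<in> E" "p \<in> orthant" shows "0 < edge_theta E \<omega> \<theta> i j p"
proof -
  let ?x = "p $ i / vertex_weight E \<omega> i" and ?y = "p $ j / vertex_weight E \<omega> j"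
  have "0 < ?x" "0 < ?y"
    using assms(2) vertex_weight_pos[OF assms(1)] vertex_weight_pos[OF edge_sym[OF assms(1)]]
    by (auto simp: orthant_def)
  then have "?x * ?y \<noteq> 0" "0 \<le> ?x" "0 \<le> ?y" by auto
  then show ?thesis
    using avg unfolding average_function_def edge_theta_def by metis
qed

lemma edge_theta_sym:
  assumes "(i, j) \<in> E" "p \<in> orthant"
  shows "edge_theta E \<omega> \<theta> i j p = edge_theta E \<omega> \<theta> j i p"
proof -
  let ?x = "p $ i / vertex_weight E \<omega> i" and ?y = "p $ j / vertex_weight E \<omega> j"
  have "0 \<le> ?x" "0 \<le> ?y"
    using assms(2) vertex_weight_pos[OF assms(1)] vertex_weight_pos[OF edge_sym[OF assms(1)]]
    by (auto simp: orthant_def intro!: divide_nonneg_nonneg less_imp_le)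
  then show ?thesis
    using avg unfolding average_function_def edge_theta_def by metis
qed

lemma C_on_edge_theta:
  assumes "(i, j) \<in> E" shows "C_on 2 (edge_theta E \<omega> \<theta> i j) orthant"
proof -
  have "C_on 2 (\<lambda>(x, y). \<theta> x y) ({0<..} \<times> {0<..})"
    using avg by (simp add: average_function_def)
  then have "C_on 2 (\<lambda>p. (\<lambda>(x, y). \<theta> x y) (p $ i / vertex_weight E \<omega> i, p $ j / vertex_weight E \<omega> j)) orthant"
  proof (rule C_on_compose[OF open_orthant _ , rotated])
    fix p :: "real^'n" assume "p \<in> orthant"
    then show "(p $ i / vertex_weight E \<omega> i, p $ j / vertex_weight E \<omega> j) \<in> {0<..} \<times> {0<..}"
      using vertex_weight_pos[OF assms] vertex_weight_pos[OF edge_sym[OF assms]]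
      by (simp add: orthant_def)
  next
    fix b :: "real \<times> real"
    have "(\<lambda>p::real^'n. (p $ i / vertex_weight E \<omega> i, p $ j / vertex_weight E \<omega> j) \<bullet> b) =
      (\<lambda>p. fst b / vertex_weight E \<omega> i * p $ i + snd b / vertex_weight E \<omega> j * p $ j)"
      by (auto simp: inner_prod_def mult.commute)
    then show "C_on 2 (\<lambda>p. (p $ i / vertex_weight E \<omega> i, p $ j / vertex_weight E \<omega> j) \<bullet> b) orthant"
      by (simp only:) (intro C_on_add C_on_cmult C_on_nth open_orthant)
  qed (intro open_Times open_greaterThan)
  then show ?thesis by (simp add: edge_theta_def[abs_def])
qed

lemma conductance_nonedge: "(i, j) \<notin> E \<Longrightarrow> conductance i j = (\<lambda>_. 0)"
  by (auto simp: conductance_def weight_nonedge)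

lemma conductance_pos: "(i, j) \<in> E \<Longrightarrow> p \<in> orthant \<Longrightarrow> 0 < conductance i j p"
  by (simp add: conductance_def weight_pos edge_theta_pos)

lemma conductance_nonneg: "p \<in> orthant \<Longrightarrow> 0 \<le> conductance i j p"
  using conductance_pos[of i j p] conductance_nonedge[of i j] by (cases "(i, j) \<in> E") auto

lemma conductance_loop [simp]: "conductance i i = (\<lambda>_. 0)"
  by (rule conductance_nonedge[OF no_loop])

lemma conductance_sym: "p \<in> orthant \<Longrightarrow> conductance i j p = conductance j i p"
  using edge_theta_sym[of i j p] weight_sym[of i j] weight_nonedge[of i j]
  by (cases "(i, j) \<in> E") (auto simp: conductance_def)

lemma C_on_conductance: "C_on 2 (conductance i j) orthant"
proof (cases "(i, j) \<in> E")
  case True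
  have "C_on 2 (\<lambda>p. \<omega> $ i $ j * edge_theta E \<omega> \<theta> i j p) orthant"
    by (intro C_on_cmult open_orthant C_on_edge_theta True)
  then show ?thesis by (simp add: conductance_def[abs_def])
qed (simp add: conductance_nonedge C_on_const open_orthant)

lemma sum_nbrs_conductance:
  "(\<Sum>j\<in>nbrs E i. conductance i j p * x j) = (\<Sum>j\<in>UNIV. conductance i j p * x j)"
  by (rule sum.mono_neutral_left) (auto simp: nbrs_def conductance_nonedge)

lemma laplacian_nth:
  assumes "p \<in> orthant"
  shows "L p $ i $ j = (if j = i then \<Sum>k\<in>UNIV. conductance i k p else - conductance i j p)"
proof (cases "j = i")
  case True
  have "L p $ i $ j = (\<Sum>k\<in>nbrs E i. conductance k i p)"
    by (simp add: laplacian_def True conductance_def)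
  also have "\<dots> = (\<Sum>k\<in>nbrs E i. conductance i k p)"
    using conductance_sym[OF assms] by simp
  finally show ?thesis using sum_nbrs_conductance[of i p "\<lambda>_. 1"] True by simp
qed (simp add: laplacian_def conductance_def)

lemma laplacian_sym: "p \<in> orthant \<Longrightarrow> L p $ i $ j = L p $ j $ i"
  using conductance_sym[of p i j] by (auto simp: laplacian_nth)

lemma laplacian_mult:
  assumes "p \<in> orthant"
  shows "(L p *v x) $ i = (\<Sum>k\<in>UNIV. conductance i k p * (x $ i - x $ k))"
proof -
  have "(L p *v x) $ i = (\<Sum>j\<in>UNIV. (if j = i then (\<Sum>k\<in>UNIV. conductance i k p) * x $ i else 0)
      - conductance i j p * x $ j)"
    unfolding matrix_vector_mult_def by (auto simp: laplacian_nth[OF assms] intro!: sum.cong)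
  then show ?thesis
    by (simp add: sum_subtractf right_diff_distrib sum_distrib_right)
qed

lemma laplacian_row_sum:
  assumes "p \<in> orthant" shows "(\<Sum>j\<in>UNIV. L p $ i $ j) = 0"
  using laplacian_mult[OF assms, of "\<chi> i. 1" i] by (simp add: matrix_vector_mult_def)

lemma C_on_laplacian: "C_on 2 (\<lambda>p. L p $ i $ j) orthant"
proof -
  have "C_on 2 (\<lambda>p. if j = i then \<Sum>k\<in>UNIV. conductance i k p else - conductance i j p) orthant"
    by (cases "j = i") (auto intro: C_on_sum C_on_minus C_on_conductance open_orthant)
  then show ?thesis
    by (rule C_on_cong[OF open_orthant]) (simp add: laplacian_nth)
qed

lemma laplacian_quadratic_form:
  assumes "p \<in> orthant"
  shows "x \<bullet> (L p *v x) = (\<Sum>i\<in>UNIV. \<Sum>k\<in>UNIV. conductance i k p * (x $ i - x $ k)\<^sup>2) / 2"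
proof -
  let ?s = "\<Sum>i\<in>UNIV. \<Sum>k\<in>UNIV. conductance i k p * (x $ i - x $ k) * x $ i"
  have 1: "x \<bullet> (L p *v x) = ?s"
    by (simp add: inner_vec_def laplacian_mult[OF assms] sum_distrib_left mult_ac)
  have "?s = (\<Sum>i\<in>UNIV. \<Sum>k\<in>UNIV. conductance k i p * (x $ k - x $ i) * x $ k)"
    by (rule sum.swap)
  also have "\<dots> = (\<Sum>i\<in>UNIV. \<Sum>k\<in>UNIV. conductance i k p * (x $ k - x $ i) * x $ k)"
    using conductance_sym[OF assms] by (intro sum.cong refl) simp
  finally have "2 * ?s = ?s + \<dots>" by simp
  also have "\<dots> = (\<Sum>i\<in>UNIV. \<Sum>k\<in>UNIV. conductance i k p * (x $ i - x $ k)\<^sup>2)"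
    by (simp add: sum.distrib[symmetric] algebra_simps power2_eq_square)
  finally show ?thesis using 1 by simp
qed

text \<open>The quadratic form is a sum of squares of differences along the edges. If it vanishes, \<open>x\<close> is
constant along edges, hence constant by connectedness, hence zero because its coordinates sum to
zero.\<close>

lemma laplacian_pos:
  assumes p: "p \<in> orthant" and x: "x \<bullet> (\<chi> i. 1) = 0" "x \<noteq> 0"
  shows "0 < x \<bullet> (L p *v x)"
proof (rule ccontr)
  let ?q = "\<lambda>i k. conductance i k p * (x $ i - x $ k)\<^sup>2"
  have nn: "0 \<le> ?q i k" for i k using conductance_nonneg[OF p] by simp
  assume "\<not> 0 < x \<bullet> (L p *v x)"
  moreover have "0 \<le> (\<Sum>i\<in>UNIV. \<Sum>k\<in>UNIV. ?q i k)"
    by (intro sum_nonneg nn)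
  ultimately have "(\<Sum>i\<in>UNIV. \<Sum>k\<in>UNIV. ?q i k) = 0"
    using laplacian_quadratic_form[OF p, of x] by simp
  then have "?q i k = 0" for i k
    by (simp add: sum_nonneg_eq_0_iff sum_nonneg nn)
  then have edge: "x $ i = x $ k" if "(i, k) \<in> E" for i k
    using conductance_pos[OF that p] by (metis eq_iff_diff_eq_0 less_irrefl mult_eq_0_iff power_eq_0_iff)
  have const: "x $ i = x $ k" for i k
  proof -
    have "(i, k) \<in> E\<^sup>*" using graph by (simp add: weighted_graph_def)
    then show ?thesis by (induction rule: rtrancl_induct) (auto dest: edge)
  qed
  have "x $ i = 0" for i
  proof -
    have "(\<Sum>k\<in>UNIV. x $ k) = (\<Sum>k\<in>(UNIV::'n set). x $ i)"
      by (intro sum.cong refl const)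
    then show ?thesis using x(1) by (simp add: inner_vec_def)
  qed
  then show False using x(2) by (simp add: vec_eq_iff)
qed

lemma eig_prod_eq_det:
  assumes p: "p \<in> orthant"
  shows "eig_prod E \<omega> \<theta> p = det (L p + (\<chi> i j. 1 / real CARD('n)))"
  unfolding eig_prod_def
  using laplacian_sym[OF p] laplacian_pos[OF p] laplacian_mult[OF p]
  by (intro eigenvalue_product_eq_det) (auto simp: vec_eq_iff)

lemma eig_prod_pos: "0 < eig_prod E \<omega> \<theta> p"
  unfolding eig_prod_def by (intro prod_pos) (auto simp: pos_eigenvalues_def)

lemma C_on_eig_prod: "C_on 2 (eig_prod E \<omega> \<theta>) orthant"
proof -
  have "C_on 2 (\<lambda>p. det (L p + (\<chi> i j. 1 / real CARD('n)))) orthant"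
    unfolding det_def by (simp, intro C_on_sum C_on_mult C_on_prod C_on_const C_on_add C_on_laplacian open_orthant)
  then show ?thesis
    by (rule C_on_cong[OF open_orthant]) (simp add: eig_prod_eq_det)
qed

lemma C_on_ln_eig_prod: "C_on 2 (\<lambda>p. ln (eig_prod E \<omega> \<theta> p)) orthant"
  using eig_prod_pos
  by (intro C_on_compose_real[OF open_orthant open_greaterThan C_on_ln _ C_on_eig_prod]) simp

end

section \<open>Adjoints of generators in divergence form\<close>

lemma divergence_transform:
  assumes "open U" "p \<in> U" "\<And>q. q \<in> U \<Longrightarrow> X q = Y q"
  shows "divergence X p = divergence Y p"
  unfolding divergence_def using assms by (intro sum.cong refl pderiv_at_transform) auto

lemma divergence_add:
  assumes "\<And>i. (\<lambda>q. X q $ i) differentiable (at p)" "\<And>i. (\<lambda>q. Y q $ i) differentiable (at p)"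
  shows "divergence (\<lambda>q. X q + Y q) p = divergence X p + divergence Y p"
  using assms by (simp add: divergence_def pderiv_at_add sum.distrib)

lemma divergence_scaleR:
  assumes "f differentiable (at p)" "\<And>i. (\<lambda>q. X q $ i) differentiable (at p)"
  shows "divergence (\<lambda>q. f q *\<^sub>R X q) p = grad f p \<bullet> X p + f p * divergence X p"
  using assms
  by (simp add: divergence_def pderiv_at_mult sum.distrib sum_distrib_left grad_def inner_vec_def)

lemma divergence_cmult:
  assumes "\<And>i. (\<lambda>q. X q $ i) differentiable (at p)"
  shows "divergence (\<lambda>q. c *\<^sub>R X q) p = c * divergence X p"
  using assms by (simp add: divergence_def pderiv_at_cmult sum_distrib_left)

lemma divergence_matrix_vector:
  assumes "\<And>i j. (\<lambda>q. L q $ i $ j) differentiable (at p)" "\<And>i. (\<lambda>q. X q $ i) differentiable (at p)"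
  shows "divergence (\<lambda>q. L q *v X q) p =
    (\<Sum>i\<in>UNIV. \<Sum>j\<in>UNIV. pderiv_at i (\<lambda>q. L q $ i $ j) p * X p $ j + L p $ i $ j * pderiv_at i (\<lambda>q. X q $ j) p)"
  using assms
  by (simp add: divergence_def matrix_vector_mult_def pderiv_at_sum pderiv_at_mult add.commute)

lemma C_on_matrix_vector:
  assumes "open U" "\<And>i j. C_on k (\<lambda>q. L q $ i $ j) U" "\<And>i. C_on k (\<lambda>q. X q $ i) U"
  shows "C_on k (\<lambda>q. (L q *v X q) $ i) U"
  unfolding matrix_vector_mult_def using assms by (simp, intro C_on_sum C_on_mult)

lemma C_on_scaleR_nth:
  assumes "open U" "C_on k f U" "\<And>i. C_on k (\<lambda>q. X q $ i) U"
  shows "C_on k (\<lambda>q. (f q *\<^sub>R X q) $ i) U"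
  using assms by (simp, intro C_on_mult)

lemma C_on_grad_nth: "C_on (Suc k) F U \<Longrightarrow> C_on k (\<lambda>q. grad F q $ i) U"
  using C_on_pderiv[of k F U i] by (simp add: grad_def)

lemma continuous_on_divergence:
  assumes "\<And>i. C_on (Suc 0) (\<lambda>q. X q $ i) U"
  shows "continuous_on U (divergence X)"
proof -
  have "continuous_on U (\<lambda>p. \<Sum>i\<in>UNIV. pderiv_at i (\<lambda>q. X q $ i) p)"
    using C_on_pderiv[OF assms] by (intro continuous_on_sum) auto
  then show ?thesis by (simp add: divergence_def[abs_def])
qed

lemma inner_matrix_sym:
  assumes "\<And>i j. A $ i $ j = A $ j $ i"
  shows "x \<bullet> (A *v y) = y \<bullet> (A *v (x :: real^'n))"
proof -
  have "transpose A = A" using assms by (simp add: transpose_def vec_eq_iff)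
  then show ?thesis
    by (metis dot_lmul_matrix inner_commute vector_transpose_matrix)
qed

text \<open>Since \<open>\<Sum>\<^sub>i X\<^sub>i = 0\<close> near the simplex, subtracting \<open>\<partial>\<^sub>k (\<Sum>\<^sub>i X\<^sub>i)\<close> for a fixed \<open>k\<close> writes the divergence
as a sum of tangential derivatives \<open>(\<partial>\<^sub>i - \<partial>\<^sub>k) X\<^sub>i\<close>.\<close>

lemma integral_divergence_tangential:
  fixes X :: "real^'n::finite \<Rightarrow> real^'n"
  assumes U: "open U" "simplex_interior \<subseteq> U" and X: "\<And>i. C_on (Suc 0) (\<lambda>q. X q $ i) U"
    and tang: "\<And>q. q \<in> U \<Longrightarrow> (\<Sum>i\<in>UNIV. X q $ i) = 0"
    and K: "compact K" "K \<subseteq> simplex_interior"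
    and X0: "\<And>p. p \<in> simplex_interior - K \<Longrightarrow> X p = 0"
  shows "set_integrable hyperplane_volume simplex_interior (divergence X)"
    and "(LINT p:simplex_interior|hyperplane_volume. divergence X p) = 0"
proof -
  \<comment> \<open>Any vertex serves as the reference direction.\<close>
  fix k :: 'n
  let ?D = "\<lambda>i p. pderiv_at i (\<lambda>q. X q $ i) p - pderiv_at k (\<lambda>q. X q $ i) p"
  have div: "divergence X p = (\<Sum>i\<in>UNIV. ?D i p)" if "p \<in> simplex_interior" for p
  proof -
    have p: "p \<in> U" using that U by auto
    have "(\<Sum>i\<in>UNIV. pderiv_at k (\<lambda>q. X q $ i) p) = pderiv_at k (\<lambda>q. \<Sum>i\<in>UNIV. X q $ i) p"
      using C_on_differentiable[OF U(1) X _ p] by (simp add: pderiv_at_sum)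
    also have "\<dots> = pderiv_at k (\<lambda>_. 0) p"
      using U(1) p tang by (rule pderiv_at_transform)
    finally show ?thesis by (simp add: divergence_def sum_subtractf)
  qed
  have D: "set_integrable hyperplane_volume simplex_interior (?D i)"
      "(LINT p:simplex_interior|hyperplane_volume. ?D i p) = 0" for i
    using integral_tangential_derivative[OF U X K, of i i k] X0 by auto
  have int: "set_integrable hyperplane_volume simplex_interior (\<lambda>p. \<Sum>i\<in>UNIV. ?D i p)"
    unfolding set_integrable_def scaleR_sum_right
    using D(1) by (intro Bochner_Integration.integrable_sum) (simp add: set_integrable_def)
  show "set_integrable hyperplane_volume simplex_interior (divergence X)"
    using int by (subst set_integrable_cong[OF refl refl div])
  have "(LINT p:simplex_interior|hyperplane_volume. divergence X p) =
      (LINT p:simplex_interior|hyperplane_volume. \<Sum>i\<in>UNIV. ?D i p)"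
    using div by (intro set_lebesgue_integral_cong) auto
  also have "\<dots> = (\<Sum>i\<in>UNIV. LINT p:simplex_interior|hyperplane_volume. ?D i p)"
    unfolding set_lebesgue_integral_def scaleR_sum_right
    using D(1) by (intro Bochner_Integration.integral_sum) (simp add: set_integrable_def)
  finally show "(LINT p:simplex_interior|hyperplane_volume. divergence X p) = 0"
    using D(2) by simp
qed

text \<open>The probability current (up to sign) of the density \<open>f\<close> for the diffusion with generator
\<open>\<beta> div (L \<nabla>\<Phi>) - \<nabla>\<Phi> \<bullet> L \<nabla>S\<close>.\<close>

definition flux ::
  "(real^'n \<Rightarrow> real^'n^'n) \<Rightarrow> (real^'n \<Rightarrow> real) \<Rightarrow> real \<Rightarrow> (real^'n \<Rightarrow> real) \<Rightarrow> real^'n::finite \<Rightarrow> real^'n" where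
  "flux L S \<beta> f q = f q *\<^sub>R (L q *v grad S q) + \<beta> *\<^sub>R (L q *v grad f q)"

text \<open>The drift \<open>\<beta> div L - L \<nabla>S\<close> contains exactly the first-order term that puts the generator in
divergence form; the divergence theorem is then applied to a field \<open>Y\<close> that is both tangential and
compactly supported in the simplex.\<close>

lemma formal_adjoint_generator:
  fixes L :: "real^'n::finite \<Rightarrow> real^'n^'n"
  assumes U: "open U" "simplex_interior \<subseteq> U"
    and L: "\<And>i j. C_on (Suc 0) (\<lambda>q. L q $ i $ j) U"
    and sym: "\<And>q i j. q \<in> U \<Longrightarrow> L q $ i $ j = L q $ j $ i"
    and row: "\<And>q i. q \<in> U \<Longrightarrow> (\<Sum>j\<in>UNIV. L q $ i $ j) = 0"
    and S: "C_on 2 S U" and f: "C_on 2 f U"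
    and b: "\<And>p i. p \<in> simplex_interior \<Longrightarrow>
      b p $ i = \<beta> * (\<Sum>j\<in>UNIV. pderiv_at j (\<lambda>q. L q $ i $ j) p) - (L p *v grad S p) $ i"
    and c: "\<And>p i j. p \<in> simplex_interior \<Longrightarrow> c p $ i $ j = 2 * \<beta> * L p $ i $ j"
  shows "formal_adjoint (generator b c) f (divergence (flux L S \<beta> f))"
    and "continuous_on simplex_interior (divergence (flux L S \<beta> f))"
proof -
  have S': "C_on (Suc (Suc 0)) S U" and f': "C_on (Suc (Suc 0)) f U" using S f by (simp_all add: numeral_2_eq_2)
  have LS: "C_on (Suc 0) (\<lambda>q. (L q *v grad S q) $ i) U" for i
    by (intro C_on_matrix_vector U L C_on_grad_nth[OF S'])
  have Lf: "C_on (Suc 0) (\<lambda>q. (L q *v grad f q) $ i) U" for i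
    by (intro C_on_matrix_vector U L C_on_grad_nth[OF f'])
  have J: "C_on (Suc 0) (\<lambda>q. flux L S \<beta> f q $ i) U" for i
    unfolding flux_def
    by (simp only: vector_add_component vector_scaleR_component real_scaleR_def)
       (intro C_on_add C_on_mult C_on_const U C_on_Suc_le[OF f'] LS Lf)
  show cont: "continuous_on simplex_interior (divergence (flux L S \<beta> f))"
    using continuous_on_divergence[OF J] U(2) by (rule continuous_on_subset)
  have tang: "(\<Sum>i\<in>UNIV. (L q *v x) $ i) = 0" if "q \<in> U" for q x
  proof -
    have "(\<Sum>i\<in>UNIV. (L q *v x) $ i) = (\<Sum>i\<in>UNIV. \<Sum>j\<in>UNIV. L q $ i $ j * x $ j)"
      by (simp add: matrix_vector_mult_def)
    also have "\<dots> = (\<Sum>j\<in>UNIV. \<Sum>i\<in>UNIV. L q $ i $ j * x $ j)"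
      by (rule sum.swap)
    also have "\<dots> = (\<Sum>j\<in>UNIV. (\<Sum>i\<in>UNIV. L q $ j $ i) * x $ j)"
      unfolding sum_distrib_right
      by (intro sum.cong refl arg_cong2[where f = "(*)"] sym[OF that])
    finally show ?thesis by (simp add: row[OF that])
  qed
  show "formal_adjoint (generator b c) f (divergence (flux L S \<beta> f))"
    unfolding formal_adjoint_def
  proof (intro conjI cont allI impI)
    fix \<Phi> :: "real^'n \<Rightarrow> real" assume "test_function \<Phi>"
    then obtain V K where V: "open V" "simplex_interior \<subseteq> V" and \<Phi>V: "C_on 2 \<Phi> V"
      and K: "compact K" "K \<subseteq> simplex_interior" and \<Phi>0: "\<And>p. p \<in> simplex_interior - K \<Longrightarrow> \<Phi> p = 0"
      unfolding test_function_def C_simplex_def by blast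
    define W where "W = U \<inter> V"
    have W: "open W" "simplex_interior \<subseteq> W" "W \<subseteq> U" using U V by (auto simp: W_def)
    have \<Phi>: "C_on (Suc (Suc 0)) \<Phi> W"
      using C_on_subset[OF V(1) W(1) _ \<Phi>V] by (simp add: W_def numeral_2_eq_2)
    note onW = C_on_subset[OF U(1) W(1,3)]
    have \<Phi>1: "C_on (Suc 0) \<Phi> W" using \<Phi> by (rule C_on_Suc_le)
    have fW: "C_on (Suc 0) f W" using onW[OF C_on_Suc_le[OF f']] .
    have L\<Phi>: "C_on (Suc 0) (\<lambda>q. (L q *v grad \<Phi> q) $ i) W" for i
      by (intro C_on_matrix_vector W onW[OF L] C_on_grad_nth[OF \<Phi>])
    define Y where "Y q = (\<beta> * f q) *\<^sub>R (L q *v grad \<Phi> q) + (- \<Phi> q) *\<^sub>R flux L S \<beta> f q" for q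
    have Y: "C_on (Suc 0) (\<lambda>q. Y q $ i) W" for i
      unfolding Y_def
      by (simp only: vector_add_component vector_scaleR_component real_scaleR_def)
         (intro C_on_add C_on_mult C_on_const C_on_minus W \<Phi>1 fW L\<Phi> onW[OF J])
    \<comment> \<open>The column sums of \<open>L\<close> are zero.\<close>
    have Ytang: "(\<Sum>i\<in>UNIV. Y q $ i) = 0" if "q \<in> W" for q
      using tang[of q] that W(3)
      by (auto simp: Y_def flux_def sum.distrib sum_subtractf sum_negf sum_distrib_left[symmetric])
    have L\<Phi>0: "(L p *v grad \<Phi> p) $ i = 0" if p: "p \<in> simplex_interior - K" for p i
    proof -
      have pW: "p \<in> W" using p W by auto
      interpret linear "frechet_derivative \<Phi> (at p)"
        using C_on_SucD[OF W(1) \<Phi> pW] by (rule has_derivative_linear)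
      have eq: "pderiv_at j \<Phi> p = pderiv_at i \<Phi> p" for j
      proof -
        have "(\<Sum>k\<in>UNIV. (axis j 1 - axis i 1 :: real^'n) $ k) = 0"
          by (simp add: sum_subtractf axis_def)
        from simplex_line_derivative(1)[OF W(1,2) \<Phi>1 K \<Phi>0 this p]
        show ?thesis by (simp add: pderiv_at_def diff)
      qed
      have "(L p *v grad \<Phi> p) $ i = (\<Sum>j\<in>UNIV. L p $ i $ j * pderiv_at i \<Phi> p)"
        unfolding matrix_vector_mult_def grad_def vec_lambda_beta
        by (intro sum.cong refl arg_cong2[where f = "(*)"] eq)
      also have "\<dots> = 0"
        using row[of p i] p U(2) by (auto simp: sum_distrib_right[symmetric])
      finally show ?thesis .
    qed
    have Y0: "Y p = 0" if "p \<in> simplex_interior - K" for p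
      using \<Phi>0[OF that] L\<Phi>0[OF that] by (simp add: Y_def vec_eq_iff)
    note intY = integral_divergence_tangential[OF W(1,2) Y Ytang K Y0]
    have int\<Phi>: "set_integrable hyperplane_volume simplex_interior (\<lambda>p. \<Phi> p * divergence (flux L S \<beta> f) p)"
    proof (rule set_integrable_compact_support[OF _ K])
      show "continuous_on simplex_interior (\<lambda>p. \<Phi> p * divergence (flux L S \<beta> f) p)"
        using cont C_on_continuous_on[OF \<Phi>] W(2)
        by (intro continuous_on_mult) (auto intro: continuous_on_subset)
    qed (simp add: \<Phi>0)
    have key: "generator b c \<Phi> p * f p = \<Phi> p * divergence (flux L S \<beta> f) p + divergence Y p"
      if p: "p \<in> simplex_interior" for p
    proof -
      have pU: "p \<in> U" and pW: "p \<in> W" using p U W by auto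
      note dU = C_on_differentiable[OF U(1) _ _ pU] and dW = C_on_differentiable[OF W(1) _ _ pW]
      have d: "\<Phi> differentiable (at p)" "f differentiable (at p)"
          "(\<lambda>q. (L q *v grad \<Phi> q) $ i) differentiable (at p)"
          "(\<lambda>q. flux L S \<beta> f q $ i) differentiable (at p)"
          "(\<lambda>q. L q $ i $ j) differentiable (at p)"
          "(\<lambda>q. grad \<Phi> q $ i) differentiable (at p)" for i j
        using dW[OF \<Phi>] dU[OF f'] dW[OF L\<Phi>] dU[OF J] dU[OF L] dW[OF C_on_grad_nth[OF \<Phi>]] by auto
      have grads: "grad (\<lambda>q. \<beta> * f q) p = \<beta> *\<^sub>R grad f p" "grad (\<lambda>q. - \<Phi> q) p = - grad \<Phi> p"
        using d(1,2) by (simp_all add: grad_def vec_eq_iff pderiv_at_cmult pderiv_at_minus)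
      have "divergence Y p = divergence (\<lambda>q. (\<beta> * f q) *\<^sub>R (L q *v grad \<Phi> q)) p +
          divergence (\<lambda>q. (- \<Phi> q) *\<^sub>R flux L S \<beta> f q) p"
        unfolding Y_def using d by (intro divergence_add) simp_all
      also have "divergence (\<lambda>q. (\<beta> * f q) *\<^sub>R (L q *v grad \<Phi> q)) p =
          \<beta> * (grad f p \<bullet> (L p *v grad \<Phi> p)) + \<beta> * f p * divergence (\<lambda>q. L q *v grad \<Phi> q) p"
        using d by (subst divergence_scaleR) (simp_all add: grads)
      also have "divergence (\<lambda>q. (- \<Phi> q) *\<^sub>R flux L S \<beta> f q) p =
          - (grad \<Phi> p \<bullet> flux L S \<beta> f p) - \<Phi> p * divergence (flux L S \<beta> f) p"
        using d by (subst divergence_scaleR) (simp_all add: grads)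
      also have "grad \<Phi> p \<bullet> flux L S \<beta> f p =
          f p * (grad \<Phi> p \<bullet> (L p *v grad S p)) + \<beta> * (grad f p \<bullet> (L p *v grad \<Phi> p))"
        using inner_matrix_sym[of "L p" "grad \<Phi> p" "grad f p", OF sym[OF pU]]
        by (simp add: flux_def inner_add_right)
      finally have divY: "\<Phi> p * divergence (flux L S \<beta> f) p + divergence Y p =
          f p * (\<beta> * divergence (\<lambda>q. L q *v grad \<Phi> q) p - grad \<Phi> p \<bullet> (L p *v grad S p))"
        by (simp add: algebra_simps)
      have divL: "divergence (\<lambda>q. L q *v grad \<Phi> q) p =
          (\<Sum>i\<in>UNIV. (\<Sum>j\<in>UNIV. pderiv_at j (\<lambda>q. L q $ i $ j) p) * pderiv_at i \<Phi> p) +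
          (\<Sum>i\<in>UNIV. \<Sum>j\<in>UNIV. L p $ i $ j * pderiv_at i (pderiv_at j \<Phi>) p)"
      proof -
        have "(\<Sum>i\<in>UNIV. \<Sum>j\<in>UNIV. pderiv_at i (\<lambda>q. L q $ i $ j) p * pderiv_at j \<Phi> p) =
            (\<Sum>j\<in>UNIV. \<Sum>i\<in>UNIV. pderiv_at i (\<lambda>q. L q $ i $ j) p * pderiv_at j \<Phi> p)"
          by (rule sum.swap)
        also have "\<dots> = (\<Sum>j\<in>UNIV. \<Sum>i\<in>UNIV. pderiv_at i (\<lambda>q. L q $ j $ i) p * pderiv_at j \<Phi> p)"
          by (intro sum.cong refl arg_cong2[where f = "(*)"] pderiv_at_transform[OF U(1) pU] sym)
        finally show ?thesis
          using d by (subst divergence_matrix_vector) (simp_all add: grad_def sum.distrib sum_distrib_right)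
      qed
      have "generator b c \<Phi> p = \<beta> * divergence (\<lambda>q. L q *v grad \<Phi> q) p - grad \<Phi> p \<bullet> (L p *v grad S p)"
      proof -
        have "b p \<bullet> grad \<Phi> p = (\<Sum>i\<in>UNIV. \<beta> * ((\<Sum>j\<in>UNIV. pderiv_at j (\<lambda>q. L q $ i $ j) p) * pderiv_at i \<Phi> p)
            - grad \<Phi> p $ i * (L p *v grad S p) $ i)"
          unfolding inner_vec_def by (simp add: b[OF p] grad_def algebra_simps)
        also have "\<dots> = \<beta> * (\<Sum>i\<in>UNIV. (\<Sum>j\<in>UNIV. pderiv_at j (\<lambda>q. L q $ i $ j) p) * pderiv_at i \<Phi> p)
            - grad \<Phi> p \<bullet> (L p *v grad S p)"
          by (simp add: sum_subtractf sum_distrib_left inner_vec_def)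
        finally show ?thesis
          unfolding generator_def divL
          by (simp add: c[OF p] sum_distrib_left[symmetric] mult.assoc distrib_left)
      qed
      then show ?thesis using divY by (simp add: mult.commute)
    qed
    have "set_integrable hyperplane_volume simplex_interior
        (\<lambda>p. \<Phi> p * divergence (flux L S \<beta> f) p + divergence Y p)"
      using int\<Phi> intY(1) by (rule set_integral_add)
    then show "set_integrable hyperplane_volume simplex_interior (\<lambda>p. generator b c \<Phi> p * f p)"
      by (subst set_integrable_cong[OF refl refl key])
    show "set_integrable hyperplane_volume simplex_interior (\<lambda>p. \<Phi> p * divergence (flux L S \<beta> f) p)"
      by (rule int\<Phi>)
    have "(LINT p:simplex_interior|hyperplane_volume. generator b c \<Phi> p * f p) =
        (LINT p:simplex_interior|hyperplane_volume. \<Phi> p * divergence (flux L S \<beta> f) p + divergence Y p)"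
      using key by (intro set_lebesgue_integral_cong) auto
    also have "\<dots> = (LINT p:simplex_interior|hyperplane_volume. \<Phi> p * divergence (flux L S \<beta> f) p)"
      using set_integral_add(2)[OF int\<Phi> intY(1)] intY(2) by simp
    finally show "(LINT p:simplex_interior|hyperplane_volume. generator b c \<Phi> p * f p) =
        (LINT p:simplex_interior|hyperplane_volume. \<Phi> p * divergence (flux L S \<beta> f) p)" .
  qed
qed

text \<open>Two representatives of \<open>A\<^sup>* f\<close> have the same integral against every test function, and both
are continuous.\<close>

lemma formal_adjoint_unique:
  fixes f g h :: "real^'n::finite \<Rightarrow> real"
  assumes g: "formal_adjoint A f g" and h: "formal_adjoint A f h" and p: "p \<in> simplex_interior"
  shows "g p = h p"
proof -
  have "g p - h p = 0"
  proof (rule test_functions_separate[OF _ _ _ p])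
    show "continuous_on simplex_interior (\<lambda>p. g p - h p)"
      using g h by (auto simp: formal_adjoint_def intro: continuous_on_diff)
    fix \<Phi> :: "real^'n \<Rightarrow> real" assume "test_function \<Phi>"
    then have *: "set_integrable hyperplane_volume simplex_interior (\<lambda>p. \<Phi> p * g p)"
        "set_integrable hyperplane_volume simplex_interior (\<lambda>p. \<Phi> p * h p)"
        "(LINT p:simplex_interior|hyperplane_volume. \<Phi> p * g p) =
         (LINT p:simplex_interior|hyperplane_volume. \<Phi> p * h p)"
      using g h unfolding formal_adjoint_def by auto
    show "set_integrable hyperplane_volume simplex_interior (\<lambda>p. \<Phi> p * (g p - h p))"
      using set_integral_diff(1)[OF *(1,2)] by (simp add: right_diff_distrib)
    show "(LINT p:simplex_interior|hyperplane_volume. \<Phi> p * (g p - h p)) = 0"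
      using set_integral_diff(2)[OF *(1,2)] *(3) by (simp add: right_diff_distrib)
  qed
  then show ?thesis by simp
qed

section \<open>The gradient drift-diffusion process\<close>

locale gradient_drift_diffusion = weighted_simplex E \<omega> \<theta>
  for E :: "('n::finite \<times> 'n) set" and \<omega> :: "real^'n^'n" and \<theta> +
  fixes V :: "real^'n \<Rightarrow> real" and \<beta> :: real
  assumes V: "smooth_simplex V" and \<beta>: "0 < \<beta>"
begin

text \<open>The potential \<open>S\<close> for which \<open>exp (- S / \<beta>)\<close> is the unnormalized stationary density.\<close>

definition eff_potential :: "real^'n \<Rightarrow> real" where
  "eff_potential p = V p + \<beta> / 2 * ln (eig_prod E \<omega> \<theta> p)"

text \<open>All derivatives are taken on one open neighbourhood of the simplex inside the orthant: there
\<open>V\<close>, \<open>log \<Pi>\<close> and the entries of \<open>L\<close> are of class \<open>C\<^sup>2\<close>.\<close>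

lemma smooth_domain:
  obtains U where "open U" "simplex_interior \<subseteq> U" "U \<subseteq> orthant" "C_on 2 V U" "C_on 2 eff_potential U"
proof -
  obtain U where U: "open U" "simplex_interior \<subseteq> U" "\<And>k. C_on k V U"
    using V unfolding smooth_simplex_def by auto
  let ?U = "U \<inter> orthant"
  have "open ?U" using U(1) open_orthant by auto
  moreover have "simplex_interior \<subseteq> ?U" using U(2) simplex_subset_orthant by auto
  moreover have VU: "C_on 2 V ?U" using C_on_subset[OF U(1) \<open>open ?U\<close> _ U(3)] by auto
  moreover have "C_on 2 eff_potential ?U"
    unfolding eff_potential_def[abs_def] using C_on_subset[OF open_orthant \<open>open ?U\<close> _ C_on_ln_eig_prod]
    by (intro C_on_add C_on_cmult VU \<open>open ?U\<close>) auto
  ultimately show thesis using that by blast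
qed

lemma pderiv_laplacian_row:
  assumes p: "p \<in> orthant"
  shows "(\<Sum>j\<in>UNIV. pderiv_at j (\<lambda>q. L q $ i $ j) p) =
    - (\<Sum>j\<in>UNIV. pderiv_at j (conductance i j) p - pderiv_at i (conductance i j) p)"
proof -
  have d: "conductance i j differentiable (at p)" for j
    using C_on_differentiable[OF open_orthant C_on_conductance _ p] by simp
  have "pderiv_at j (\<lambda>q. L q $ i $ j) p =
      (if j = i then \<Sum>k\<in>UNIV. pderiv_at i (conductance i k) p else 0) - pderiv_at j (conductance i j) p" for j
  proof -
    have "pderiv_at j (\<lambda>q. L q $ i $ j) p =
        pderiv_at j (\<lambda>q. if j = i then \<Sum>k\<in>UNIV. conductance i k q else - conductance i j q) p"
      by (rule pderiv_at_transform[OF open_orthant p]) (rule laplacian_nth)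
    then show ?thesis using d by (simp add: pderiv_at_sum pderiv_at_minus)
  qed
  then show ?thesis by (simp add: sum_subtractf)
qed

text \<open>On the orthant \<open>V + \<beta> log (\<Pi>\<^sup>1\<^sup>/\<^sup>2 / \<theta>\<^sub>i\<^sub>j) = S - \<beta> log \<theta>\<^sub>i\<^sub>j\<close>. The factor \<open>\<omega>\<^sub>i\<^sub>j \<theta>\<^sub>i\<^sub>j\<close> in front turns
the derivative of the logarithm into the derivative of the conductance, and these derivatives add
up to the divergence of the rows of \<open>L\<close>.\<close>

lemma drift_eq:
  assumes p: "p \<in> simplex_interior"
  shows "sde_drift E \<omega> \<theta> V \<beta> p $ i =
    \<beta> * (\<Sum>j\<in>UNIV. pderiv_at j (\<lambda>q. L q $ i $ j) p) - (L p *v grad eff_potential p) $ i"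
proof -
  obtain U where U: "open U" "simplex_interior \<subseteq> U" "U \<subseteq> orthant" "C_on 2 eff_potential U" using smooth_domain by metis
  have pU: "p \<in> U" and po: "p \<in> orthant" using p U by auto
  have dS: "eff_potential differentiable (at p)" using C_on_differentiable[OF U(1,4) _ pU] by simp
  have edge: "sqrt (\<omega> $ i $ j) * edge_theta E \<omega> \<theta> i j p * edge_deriv \<omega> i j
      (\<lambda>q. V q + \<beta> * ln (eig_prod E \<omega> \<theta> q powr (1/2) / edge_theta E \<omega> \<theta> i j q)) p =
      conductance i j p * (grad eff_potential p $ j - grad eff_potential p $ i) -
      \<beta> * (pderiv_at j (conductance i j) p - pderiv_at i (conductance i j) p)"
    if "j \<in> nbrs E i" for j
  proof -
    have e: "(i, j) \<in> E" using that by (simp add: nbrs_def)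
    let ?t = "edge_theta E \<omega> \<theta> i j"
    have t: "0 < ?t p" using edge_theta_pos[OF e po] .
    have dt: "?t differentiable (at p)" using C_on_differentiable[OF open_orthant C_on_edge_theta[OF e] _ po] by simp
    have dln: "(\<lambda>q. ln (?t q)) differentiable (at p)"
      using C_on_differentiable[OF open_orthant _ _ po, of 2 "\<lambda>q. ln (?t q)"]
        C_on_compose_real[OF open_orthant open_greaterThan C_on_ln _ C_on_edge_theta[OF e]] edge_theta_pos[OF e]
      by simp
    have D: "pderiv_at k (\<lambda>q. V q + \<beta> * ln (eig_prod E \<omega> \<theta> q powr (1/2) / ?t q)) p =
        grad eff_potential p $ k - \<beta> * (pderiv_at k ?t p / ?t p)" for k
    proof -
      have "pderiv_at k (\<lambda>q. V q + \<beta> * ln (eig_prod E \<omega> \<theta> q powr (1/2) / ?t q)) p =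
          pderiv_at k (\<lambda>q. eff_potential q - \<beta> * ln (?t q)) p"
      proof (rule pderiv_at_transform[OF open_orthant po])
        fix q :: "real^'n" assume "q \<in> orthant"
        then show "V q + \<beta> * ln (eig_prod E \<omega> \<theta> q powr (1/2) / ?t q) = eff_potential q - \<beta> * ln (?t q)"
          using edge_theta_pos[OF e, of q] eig_prod_pos[of q]
          by (simp add: eff_potential_def ln_div ln_powr algebra_simps)
      qed
      also have "\<dots> = grad eff_potential p $ k - \<beta> * pderiv_at k (\<lambda>q. ln (?t q)) p"
        using dS dln by (simp add: pderiv_at_diff pderiv_at_cmult grad_def)
      also have "pderiv_at k (\<lambda>q. ln (?t q)) p = pderiv_at k ?t p / ?t p"
        using pderiv_at_compose_real[OF dt DERIV_ln[OF t]] by (simp add: divide_inverse mult.commute)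
      finally show ?thesis .
    qed
    have C: "pderiv_at k (conductance i j) p = \<omega> $ i $ j * pderiv_at k ?t p" for k
      using pderiv_at_cmult[OF dt] by (simp add: conductance_def[abs_def])
    have sq: "sqrt (\<omega> $ i $ j) * ?t p * (sqrt (\<omega> $ i $ j) * x) = \<omega> $ i $ j * ?t p * x" for x
      using weight_pos[OF e] by simp
    show ?thesis
      unfolding edge_deriv_def D C sq unfolding conductance_def using t
      by (simp add: field_simps)
  qed
  have "sde_drift E \<omega> \<theta> V \<beta> p $ i = (\<Sum>j\<in>nbrs E i. conductance i j p * (grad eff_potential p $ j - grad eff_potential p $ i) -
      \<beta> * (pderiv_at j (conductance i j) p - pderiv_at i (conductance i j) p))"
    unfolding sde_drift_def using edge by simp
  also have "\<dots> = (\<Sum>j\<in>UNIV. conductance i j p * (grad eff_potential p $ j - grad eff_potential p $ i) -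
      \<beta> * (pderiv_at j (conductance i j) p - pderiv_at i (conductance i j) p))"
    by (rule sum.mono_neutral_left) (auto simp: nbrs_def conductance_nonedge)
  also have "\<dots> = \<beta> * (\<Sum>j\<in>UNIV. pderiv_at j (\<lambda>q. L q $ i $ j) p) - (L p *v grad eff_potential p) $ i"
    unfolding pderiv_laplacian_row[OF po] laplacian_mult[OF po]
    by (simp add: sum_subtractf sum.distrib sum_distrib_left sum_negf algebra_simps)
  finally show ?thesis .
qed

text \<open>The process moves mass along edges: \<open>B\<^sub>i\<^sub>j\<close> and \<open>B\<^sub>j\<^sub>i\<close> enter the coordinates \<open>i\<close> and \<open>j\<close> with opposite
signs. Both orientations contribute the same amount, whence the factor \<open>2\<close>.\<close>

lemma covariation_eq:
  assumes p: "p \<in> simplex_interior"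
  shows "covariation (sde_dispersion E \<omega> \<theta> \<beta>) p $ i $ j = 2 * \<beta> * L p $ i $ j"
proof -
  have po: "p \<in> orthant" using p simplex_subset_orthant by auto
  define s where "s i k = sqrt (conductance i k p)" for i k
  have ss: "s i k * s i k = conductance i k p" "s i k * s k i = conductance i k p" for i k
    using conductance_nonneg[OF po, of i k] conductance_sym[OF po, of k i] by (simp_all add: s_def)
  have if_sum: "(\<Sum>l\<in>UNIV. if Q then g l else 0) = (if Q then \<Sum>l\<in>UNIV. g l else 0)"
    for Q and g :: "'n \<Rightarrow> real" by simp
  have disp: "sde_dispersion E \<omega> \<theta> \<beta> p $ i $ (k, l) =
      sqrt \<beta> * (of_bool (k = i) * s i l - of_bool (l = i) * s i k)" for i k l
  proof -
    have "(\<Sum>j\<in>nbrs E i. s i j * (of_bool ((k, l) = (i, j)) - of_bool ((k, l) = (j, i)))) =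
        (\<Sum>j\<in>UNIV. s i j * (of_bool ((k, l) = (i, j)) - of_bool ((k, l) = (j, i))))"
      by (rule sum.mono_neutral_left) (auto simp: nbrs_def s_def conductance_nonedge)
    also have "\<dots> = (\<Sum>j\<in>UNIV. (if l = j then of_bool (k = i) * s i l else 0) - (if k = j then of_bool (l = i) * s i k else 0))"
      by (intro sum.cong refl) auto
    also have "\<dots> = of_bool (k = i) * s i l - of_bool (l = i) * s i k"
      by (simp add: sum_subtractf)
    finally show ?thesis by (simp add: sde_dispersion_def s_def conductance_def)
  qed
  have "covariation (sde_dispersion E \<omega> \<theta> \<beta>) p $ i $ j =
      (\<Sum>m\<in>UNIV \<times> UNIV. sde_dispersion E \<omega> \<theta> \<beta> p $ i $ m * sde_dispersion E \<omega> \<theta> \<beta> p $ j $ m)"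
    by (simp add: covariation_def matrix_matrix_mult_def transpose_def)
  also have "\<dots> = (\<Sum>k\<in>UNIV. \<Sum>l\<in>UNIV. sde_dispersion E \<omega> \<theta> \<beta> p $ i $ (k, l) * sde_dispersion E \<omega> \<theta> \<beta> p $ j $ (k, l))"
    by (simp only: sum.cartesian_product case_prod_unfold prod.collapse)
  also have "\<dots> = (\<Sum>k\<in>UNIV. \<Sum>l\<in>UNIV. \<beta> *
      ((if k = i then of_bool (i = j) * conductance i l p else 0)
       + (if l = i then of_bool (i = j) * conductance i k p else 0)
       - (if k = i then if l = j then conductance i j p else 0 else 0)
       - (if k = j then if l = i then conductance i j p else 0 else 0)))"
    unfolding disp
  proof (intro sum.cong refl)
    fix k l
    have sq: "sqrt \<beta> * x * (sqrt \<beta> * y) = \<beta> * (x * y)" for x y using \<beta> by simp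
    show "sqrt \<beta> * (of_bool (k = i) * s i l - of_bool (l = i) * s i k) *
        (sqrt \<beta> * (of_bool (k = j) * s j l - of_bool (l = j) * s j k)) = \<beta> *
      ((if k = i then of_bool (i = j) * conductance i l p else 0)
       + (if l = i then of_bool (i = j) * conductance i k p else 0)
       - (if k = i then if l = j then conductance i j p else 0 else 0)
       - (if k = j then if l = i then conductance i j p else 0 else 0))"
      unfolding sq by (rule arg_cong[where f = "(*) \<beta>"]) (use ss in \<open>auto simp: algebra_simps\<close>)
  qed
  also have "\<dots> = \<beta> * (2 * of_bool (i = j) * (\<Sum>k\<in>UNIV. conductance i k p) - 2 * conductance i j p)"
    by (simp add: sum_distrib_left[symmetric] sum_subtractf sum.distrib if_sum)
  also have "\<dots> = 2 * \<beta> * L p $ i $ j"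
    by (auto simp: laplacian_nth[OF po])
  finally show ?thesis .
qed

text \<open>The second equation expands \<open>\<nabla>S\<close> inside the flux; it needs an identity of vector fields near \<open>p\<close>,
not only at \<open>p\<close>, because a divergence is taken.\<close>

lemma fokker_planck_operator:
  assumes P: "C_simplex 2 P"
  shows "formal_adjoint (generator (sde_drift E \<omega> \<theta> V \<beta>) (covariation (sde_dispersion E \<omega> \<theta> \<beta>))) P
      (divergence (flux L eff_potential \<beta> P))"
    and "\<And>p. p \<in> simplex_interior \<Longrightarrow> divergence (flux L eff_potential \<beta> P) p =
      divergence (\<lambda>q. P q *\<^sub>R (L q *v grad V q)) p + \<beta> * LW_adj E \<omega> \<theta> P p"
proof -
  obtain U\<^sub>0 where U\<^sub>0: "open U\<^sub>0" "simplex_interior \<subseteq> U\<^sub>0" "U\<^sub>0 \<subseteq> orthant" "C_on 2 V U\<^sub>0" "C_on 2 eff_potential U\<^sub>0"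
    using smooth_domain by metis
  obtain U\<^sub>1 where U\<^sub>1: "open U\<^sub>1" "simplex_interior \<subseteq> U\<^sub>1" "C_on 2 P U\<^sub>1"
    using P unfolding C_simplex_def by auto
  define U where "U = U\<^sub>0 \<inter> U\<^sub>1"
  have U: "open U" "simplex_interior \<subseteq> U" "U \<subseteq> orthant"
    using U\<^sub>0 U\<^sub>1 by (auto simp: U_def)
  have C: "C_on (Suc (Suc 0)) V U" "C_on 2 eff_potential U" "C_on 2 P U"
    using C_on_subset[OF U\<^sub>0(1) U(1) _ U\<^sub>0(4)] C_on_subset[OF U\<^sub>0(1) U(1) _ U\<^sub>0(5)]
      C_on_subset[OF U\<^sub>1(1) U(1) _ U\<^sub>1(3)]
    by (auto simp: U_def numeral_2_eq_2)
  have LU: "C_on (Suc 0) (\<lambda>q. L q $ i $ j) U" for i j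
    using C_on_subset[OF open_orthant U(1,3) C_on_laplacian] C_on_Suc_le by (metis numeral_2_eq_2)
  have lnU: "C_on (Suc (Suc 0)) (\<lambda>q. ln (eig_prod E \<omega> \<theta> q)) U"
    using C_on_subset[OF open_orthant U(1,3) C_on_ln_eig_prod] by (simp add: numeral_2_eq_2)
  have PU: "C_on (Suc (Suc 0)) P U" using C(3) by (simp add: numeral_2_eq_2)
  show "formal_adjoint (generator (sde_drift E \<omega> \<theta> V \<beta>) (covariation (sde_dispersion E \<omega> \<theta> \<beta>))) P
      (divergence (flux L eff_potential \<beta> P))"
    by (rule formal_adjoint_generator[OF U(1,2) LU _ _ C(2,3) drift_eq covariation_eq])
       (use U(3) laplacian_sym laplacian_row_sum in auto)
  fix p :: "real^'n" assume p: "p \<in> simplex_interior"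
  then have pU: "p \<in> U" using U by auto
  define X\<^sub>V where "X\<^sub>V q = P q *\<^sub>R (L q *v grad V q)" for q
  define X\<^sub>\<Pi> where "X\<^sub>\<Pi> q = P q *\<^sub>R (L q *v grad (\<lambda>r. ln (eig_prod E \<omega> \<theta> r)) q)" for q
  define X\<^sub>P where "X\<^sub>P q = L q *v grad P q" for q
  have "C_on (Suc 0) (\<lambda>q. X\<^sub>V q $ i) U" "C_on (Suc 0) (\<lambda>q. X\<^sub>\<Pi> q $ i) U" "C_on (Suc 0) (\<lambda>q. X\<^sub>P q $ i) U" for i
    unfolding X\<^sub>V_def X\<^sub>\<Pi>_def X\<^sub>P_def
    by (intro C_on_scaleR_nth C_on_matrix_vector U LU C_on_grad_nth C_on_Suc_le[OF PU] C lnU PU)+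
  then have d: "(\<lambda>q. X\<^sub>V q $ i) differentiable (at p)" "(\<lambda>q. X\<^sub>\<Pi> q $ i) differentiable (at p)"
      "(\<lambda>q. X\<^sub>P q $ i) differentiable (at p)" for i
    using C_on_differentiable[OF U(1) _ _ pU] by blast+
  have "divergence (flux L eff_potential \<beta> P) p = divergence (\<lambda>q. X\<^sub>V q + ((\<beta> / 2) *\<^sub>R X\<^sub>\<Pi> q + \<beta> *\<^sub>R X\<^sub>P q)) p"
  proof (rule divergence_transform[OF U(1) pU])
    fix q assume q: "q \<in> U"
    have dq: "V differentiable (at q)" "(\<lambda>r. ln (eig_prod E \<omega> \<theta> r)) differentiable (at q)"
        "(\<lambda>r. \<beta> / 2 * ln (eig_prod E \<omega> \<theta> r)) differentiable (at q)"
      using C_on_differentiable[OF U(1) _ _ q] C(1) lnU C_on_cmult[OF U(1) lnU] by blast+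
    have "pderiv_at i eff_potential q = pderiv_at i V q + \<beta> / 2 * pderiv_at i (\<lambda>r. ln (eig_prod E \<omega> \<theta> r)) q" for i
      unfolding eff_potential_def[abs_def] by (simp only: pderiv_at_add[OF dq(1,3)] pderiv_at_cmult[OF dq(2)])
    then have "grad eff_potential q = grad V q + (\<beta> / 2) *\<^sub>R grad (\<lambda>r. ln (eig_prod E \<omega> \<theta> r)) q"
      by (simp add: grad_def vec_eq_iff)
    then show "flux L eff_potential \<beta> P q = X\<^sub>V q + ((\<beta> / 2) *\<^sub>R X\<^sub>\<Pi> q + \<beta> *\<^sub>R X\<^sub>P q)"
      by (simp add: flux_def X\<^sub>V_def X\<^sub>\<Pi>_def X\<^sub>P_def matrix_vector_right_distrib matrix_vector_mult_scaleR
          scaleR_add_right mult.commute)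
  qed
  also have "\<dots> = divergence X\<^sub>V p + (\<beta> / 2 * divergence X\<^sub>\<Pi> p + \<beta> * divergence X\<^sub>P p)"
    using d by (simp add: divergence_add divergence_cmult)
  finally show "divergence (flux L eff_potential \<beta> P) p =
      divergence (\<lambda>q. P q *\<^sub>R (L q *v grad V q)) p + \<beta> * LW_adj E \<omega> \<theta> P p"
    by (simp add: LW_adj_def X\<^sub>V_def[abs_def] X\<^sub>\<Pi>_def[abs_def] X\<^sub>P_def[abs_def] algebra_simps)
qed

lemma fokker_planck_iff:
  assumes "C_simplex 2 (P t)"
  shows "fokker_planck_at (sde_drift E \<omega> \<theta> V \<beta>) (sde_dispersion E \<omega> \<theta> \<beta>) P t \<longleftrightarrow>
    (\<forall>p\<in>simplex_interior. ((\<lambda>s. P s p) has_real_derivative divergence (flux L eff_potential \<beta> (P t)) p) (at t))"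
    (is "_ \<longleftrightarrow> ?rhs")
proof
  assume "fokker_planck_at (sde_drift E \<omega> \<theta> V \<beta>) (sde_dispersion E \<omega> \<theta> \<beta>) P t"
  then obtain g where
    g: "formal_adjoint (generator (sde_drift E \<omega> \<theta> V \<beta>) (covariation (sde_dispersion E \<omega> \<theta> \<beta>))) (P t) g"
      "\<forall>p\<in>simplex_interior. ((\<lambda>s. P s p) has_real_derivative g p) (at t)"
    unfolding fokker_planck_at_def by blast
  show ?rhs
    using g(2) formal_adjoint_unique[OF g(1) fokker_planck_operator(1)[OF assms]] by simp
next
  assume ?rhs
  then show "fokker_planck_at (sde_drift E \<omega> \<theta> V \<beta>) (sde_dispersion E \<omega> \<theta> \<beta>) P t"
    unfolding fokker_planck_at_def using fokker_planck_operator(1)[OF assms] by blast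
qed

lemma gibbs_weight_eq: "gibbs_weight E \<omega> \<theta> V \<beta> p = exp (- (1 / \<beta>) * eff_potential p)"
proof -
  have "- (1 / \<beta>) * eff_potential p = - (1 / \<beta>) * V p + - (1/2) * ln (eig_prod E \<omega> \<theta> p)"
    using \<beta> by (simp add: eff_potential_def field_simps)
  moreover have "eig_prod E \<omega> \<theta> p \<noteq> 0" using eig_prod_pos[of p] by simp
  ultimately show ?thesis
    by (simp only: gibbs_weight_def powr_def if_False mult_exp_exp)
qed

text \<open>For \<open>\<rho> = a exp (- S / \<beta>)\<close> one has \<open>\<beta> \<nabla>\<rho> = - \<rho> \<nabla>S\<close>, so the two terms of the flux cancel.\<close>

lemma gibbs_stationary:
  fixes a :: real
  defines "\<rho> \<equiv> \<lambda>p. a * gibbs_weight E \<omega> \<theta> V \<beta> p"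
  shows "stationary_solution (sde_drift E \<omega> \<theta> V \<beta>) (sde_dispersion E \<omega> \<theta> \<beta>) \<rho>"
proof -
  obtain U where U: "open U" "simplex_interior \<subseteq> U" "U \<subseteq> orthant" "C_on 2 eff_potential U" using smooth_domain by metis
  have \<rho>: "\<rho> = (\<lambda>p. a * exp (- (1 / \<beta>) * eff_potential p))" by (simp add: \<rho>_def gibbs_weight_eq)
  have "C_on 2 \<rho> U"
    unfolding \<rho>
    by (rule C_on_cmult[OF U(1) C_on_compose_real[OF U(1) open_UNIV C_on_exp _ C_on_cmult[OF U(1,4)]]]) simp
  then have C: "C_simplex 2 \<rho>" using U unfolding C_simplex_def by blast
  have "flux L eff_potential \<beta> \<rho> q = 0" if q: "q \<in> U" for q
  proof -
    have dS: "eff_potential differentiable (at q)" using C_on_differentiable[OF U(1,4) _ q] by simp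
    have "pderiv_at i \<rho> q = - (\<rho> q / \<beta>) * pderiv_at i eff_potential q" for i
    proof -
      have "((\<lambda>s. a * exp (- (1 / \<beta>) * s)) has_real_derivative - (\<rho> q / \<beta>)) (at (eff_potential q))"
        using \<beta> by (auto simp: \<rho> intro!: derivative_eq_intros)
      from pderiv_at_compose_real[OF dS this] show ?thesis by (simp add: \<rho>)
    qed
    then have "grad \<rho> q = (- (\<rho> q / \<beta>)) *\<^sub>R grad eff_potential q"
      by (simp add: grad_def vec_eq_iff)
    then show ?thesis
      using \<beta> by (simp only: flux_def matrix_vector_mult_scaleR) simp
  qed
  then have "divergence (flux L eff_potential \<beta> \<rho>) p = divergence (\<lambda>_. 0) p" if "p \<in> simplex_interior" for p
    using that U by (intro divergence_transform[OF U(1)]) auto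
  then have "divergence (flux L eff_potential \<beta> \<rho>) p = 0" if "p \<in> simplex_interior" for p
    using that by (simp add: divergence_def)
  then have "fokker_planck_at (sde_drift E \<omega> \<theta> V \<beta>) (sde_dispersion E \<omega> \<theta> \<beta>) (\<lambda>_. \<rho>) t" for t
    using C by (subst fokker_planck_iff) auto
  then show ?thesis using C by (simp add: stationary_solution_def)
qed

lemma gibbs_prob_density:
  defines "Z \<equiv> (LINT p:simplex_interior|hyperplane_volume. gibbs_weight E \<omega> \<theta> V \<beta> p)"
  assumes int: "set_integrable hyperplane_volume simplex_interior (gibbs_weight E \<omega> \<theta> V \<beta>)"
  shows "prob_density (\<lambda>p. 1 / Z * gibbs_weight E \<omega> \<theta> V \<beta> p)"
proof -
  have "(\<chi> i. 1 / real CARD('n)) \<in> UNIV \<inter> (simplex_interior :: (real^'n) set)"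
    by (simp add: simplex_interior_def)
  then have Z: "0 < Z"
    unfolding Z_def by (intro set_integral_simplex_pos[OF int _ open_UNIV]) (auto simp: gibbs_weight_eq)
  have nonneg: "0 \<le> gibbs_weight E \<omega> \<theta> V \<beta> p" for p by (simp add: gibbs_weight_eq)
  have "(LINT p:simplex_interior|hyperplane_volume. 1 / Z * gibbs_weight E \<omega> \<theta> V \<beta> p) = 1 / Z * Z"
    unfolding Z_def by (rule set_integral_mult_right)
  then show ?thesis
    using Z int unfolding prob_density_def
    by (auto simp: nonneg intro!: set_integrable_mult_right)
qed

end

theorem proposition3:
  fixes E :: "('n::finite \<times> 'n) set"
    and \<omega> :: "real^'n^'n"
    and \<theta> :: "real \<Rightarrow> real \<Rightarrow> real"
    and V :: "real^'n \<Rightarrow> real"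
    and \<beta> :: real
  defines "b \<equiv> sde_drift E \<omega> \<theta> V \<beta>"
    and "\<sigma> \<equiv> sde_dispersion E \<omega> \<theta> \<beta>"
    and "Z \<equiv> (LINT p:simplex_interior|hyperplane_volume. gibbs_weight E \<omega> \<theta> V \<beta> p)"
  assumes "weighted_graph E \<omega>"
    and "average_function \<theta>"
    and "smooth_simplex V"
    and "\<beta> > 0"
  shows "(\<forall>P t. C_simplex 2 (P t) \<longrightarrow>
            (fokker_planck_at b \<sigma> P t \<longleftrightarrow>
              (\<forall>p\<in>simplex_interior.
                 ((\<lambda>s. P s p) has_real_derivative
                    divergence (\<lambda>q. P t q *\<^sub>R (laplacian E \<omega> \<theta> q *v grad V q)) p
                    + \<beta> * LW_adj E \<omega> \<theta> (P t) p) (at t)))) \<and>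
         (set_integrable hyperplane_volume simplex_interior (gibbs_weight E \<omega> \<theta> V \<beta>) \<longrightarrow>
            prob_density (\<lambda>p. 1 / Z * gibbs_weight E \<omega> \<theta> V \<beta> p) \<and>
            stationary_solution b \<sigma> (\<lambda>p. 1 / Z * gibbs_weight E \<omega> \<theta> V \<beta> p))"
proof -
  interpret gradient_drift_diffusion E \<omega> \<theta> V \<beta>
    using assms(4-7) by unfold_locales
  show ?thesis
    unfolding b_def \<sigma>_def Z_def
    by (intro conjI allI impI gibbs_prob_density gibbs_stationary)
       (simp add: fokker_planck_iff fokker_planck_operator(2))
qed

end
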